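(* Let $z_1,\dots,z_n\in\mathbb{C}$, let $\nu\vdash n$, and let $\lambda$ be a partition. Let $\beta^\lambda_\nu\in\mathrm{End}(M^\nu)$ denote the operator $\beta^\lambda$ acting on the Specht module $M^\nu$, where $M^\nu$ is equipped with a Hermitian inner product such that every $\sigma\in\mathfrak{S}_n$ acts as a unitary operator. (i) If $z_1,\dots,z_n\in\mathbb{R}$, then $\beta^\lambda_\nu$ is a self-adjoint operator. (ii) If $z_1,\dots,z_n\in[0,\infty)$, then $\beta^\lambda_\nu$ is positive semidefinite for all $\lambda,\nu$. (iii) If $z_1,\dots,z_n\in(0,\infty)$ and $\lambda\subseteq\nu$, then $\beta^\lambda_\nu$ is positive definite. (iv) If $\lambda\not\subseteq\nu$, then $\beta^\lambda_\nu=0$.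
   Context: $[n]=\{1,\dots,n\}$; $M^\lambda$ is the Specht module (irreducible complex representation of $\mathfrak{S}_{|\lambda|}$ attached to the partition $\lambda$) and $\chi^\lambda$ its character. For $X\subseteq[n]$, $\mathfrak{S}_X\subseteq\mathfrak{S}_n$ is the group of permutations of $X$ (fixing $[n]\setminus X$ pointwise), and for $|X|=|\lambda|$, $\chi^\lambda$ is regarded as a function on $\mathfrak{S}_X\cong\mathfrak{S}_{|X|}$. Define $$\beta^\lambda:=\sum_{X\subseteq[n],\,|X|=|\lambda|}\ \sum_{\sigma\in\mathfrak{S}_X}\chi^\lambda(\sigma)\,\sigma\prod_{i\in[n]\setminus X}z_i\in\mathbb{C}[\mathfrak{S}_n].$$ $\lambda\subseteq\nu$ means $\lambda_i\le\nu_i$ for all $i$. *)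

theory Defs
  imports
    Complex_Main
    "HOL-Library.Function_Algebras"
    "HOL-Combinatorics.Permutations"
begin

text \<open>
  The free complex vector space on a type \<open>'t\<close> is taken inside the space of functions
  \<open>'t \<Rightarrow> complex\<close> with pointwise operations; \<open>point t\<close> is the basis vector of \<open>t\<close>.
  It is used both for the group algebra and for the permutation modules on tabloids.
\<close>

definition cscale :: "complex \<Rightarrow> ('t \<Rightarrow> complex) \<Rightarrow> 't \<Rightarrow> complex"  (infixr "*\<^sub>C" 75)
  where "c *\<^sub>C v = (\<lambda>t. c * v t)"

definition point :: "'t \<Rightarrow> 't \<Rightarrow> complex"
  where "point t = (\<lambda>s. if s = t then 1 else 0)"

global_interpretation cfun: vector_space "cscale :: complex \<Rightarrow> ('t \<Rightarrow> complex) \<Rightarrow> 't \<Rightarrow> complex"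
  by unfold_locales (auto simp: cscale_def fun_eq_iff algebra_simps)

text \<open>The value does not depend on the choice of the basis when the subspace \<open>V\<close> is
  finite-dimensional.\<close>

definition trace_on :: "('t \<Rightarrow> complex) set \<Rightarrow> (('t \<Rightarrow> complex) \<Rightarrow> 't \<Rightarrow> complex) \<Rightarrow> complex"
  where "trace_on V A =
    (let B = (SOME B. B \<subseteq> V \<and> cfun.independent B \<and> cfun.span B = V)
     in \<Sum>b\<in>B. cfun.representation B (A b) b)"


section \<open>Partitions, tableaux and Specht modules\<close>

text \<open>A partition is its sequence of parts, padded by zeros and indexed from 0
  (so \<open>lam 0\<close> is the largest part).\<close>

definition is_partition :: "(nat \<Rightarrow> nat) \<Rightarrow> bool"
  where "is_partition lam \<longleftrightarrow> antimono lam \<and> finite {i. lam i \<noteq> 0}"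

definition psize :: "(nat \<Rightarrow> nat) \<Rightarrow> nat"
  where "psize lam = (\<Sum>i | lam i \<noteq> 0. lam i)"

definition diagram :: "(nat \<Rightarrow> nat) \<Rightarrow> (nat \<times> nat) set"
  where "diagram lam = {(i, j). j < lam i}"

definition tableau :: "(nat \<Rightarrow> nat) \<Rightarrow> (nat \<times> nat \<Rightarrow> nat) \<Rightarrow> bool"
  where "tableau lam t \<longleftrightarrow> bij_betw t (diagram lam) {1..psize lam}"

text \<open>The tabloid of a tableau (its class modulo permutations within the rows) is encoded by
  the sequence of the sets of entries of its rows.\<close>

definition tabloid :: "(nat \<Rightarrow> nat) \<Rightarrow> (nat \<times> nat \<Rightarrow> nat) \<Rightarrow> nat \<Rightarrow> nat set"
  where "tabloid lam t = (\<lambda>i. {t (i, j) | j. (i, j) \<in> diagram lam})"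

definition tableau_column :: "(nat \<Rightarrow> nat) \<Rightarrow> (nat \<times> nat \<Rightarrow> nat) \<Rightarrow> nat \<Rightarrow> nat set"
  where "tableau_column lam t j = {t (i, j) | i. (i, j) \<in> diagram lam}"

definition column_stabilizer :: "(nat \<Rightarrow> nat) \<Rightarrow> (nat \<times> nat \<Rightarrow> nat) \<Rightarrow> (nat \<Rightarrow> nat) set"
  where "column_stabilizer lam t =
    {p. p permutes {1..psize lam} \<and> (\<forall>j. p ` tableau_column lam t j = tableau_column lam t j)}"

definition polytabloid :: "(nat \<Rightarrow> nat) \<Rightarrow> (nat \<times> nat \<Rightarrow> nat) \<Rightarrow> (nat \<Rightarrow> nat set) \<Rightarrow> complex"
  where "polytabloid lam t =
    (\<Sum>p\<in>column_stabilizer lam t. of_int (sign p) *\<^sub>C point (tabloid lam (p \<circ> t)))"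

definition specht :: "(nat \<Rightarrow> nat) \<Rightarrow> ((nat \<Rightarrow> nat set) \<Rightarrow> complex) set"
  where "specht lam = cfun.span {polytabloid lam t | t. tableau lam t}"

text \<open>The left action of permutations, with \<open>p \<cdot> point T = point (\<lambda>i. p ` T i)\<close>.\<close>

definition perm_act ::
    "(nat \<Rightarrow> nat) \<Rightarrow> ((nat \<Rightarrow> nat set) \<Rightarrow> complex) \<Rightarrow> (nat \<Rightarrow> nat set) \<Rightarrow> complex"
  where "perm_act p v = (\<lambda>T. v (\<lambda>i. inv p ` T i))"

definition specht_char :: "(nat \<Rightarrow> nat) \<Rightarrow> (nat \<Rightarrow> nat) \<Rightarrow> complex"
  where "specht_char lam p = trace_on (specht lam) (perm_act p)"

text \<open>For \<open>card X = psize lam\<close>, permutations of \<open>X\<close> are identified with permutations of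
  \<open>{1..psize lam}\<close> by means of the increasing bijection \<open>X \<rightarrow> {1..card X}\<close>; as characters are class
  functions, any other bijection gives the same function.\<close>

definition specht_char_on :: "nat set \<Rightarrow> (nat \<Rightarrow> nat) \<Rightarrow> (nat \<Rightarrow> nat) \<Rightarrow> complex"
  where "specht_char_on X lam p =
    specht_char lam (map_permutation X (\<lambda>x. card {y \<in> X. y \<le> x}) p)"


section \<open>The group algebra element and its action\<close>

text \<open>Elements of the group algebra of the symmetric group on \<open>{1..n}\<close> are coefficient
  functions on permutations.\<close>

definition beta :: "nat \<Rightarrow> (nat \<Rightarrow> complex) \<Rightarrow> (nat \<Rightarrow> nat) \<Rightarrow> (nat \<Rightarrow> nat) \<Rightarrow> complex"
  where "beta n z lam =
    (\<Sum>X | X \<subseteq> {1..n} \<and> card X = psize lam. \<Sum>p | p permutes X.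
       (specht_char_on X lam p * (\<Prod>i\<in>{1..n} - X. z i)) *\<^sub>C point p)"

definition group_algebra_act ::
    "nat \<Rightarrow> ((nat \<Rightarrow> nat) \<Rightarrow> complex) \<Rightarrow> ((nat \<Rightarrow> nat set) \<Rightarrow> complex) \<Rightarrow> (nat \<Rightarrow> nat set) \<Rightarrow> complex"
  where "group_algebra_act n a v = (\<Sum>p | p permutes {1..n}. a p *\<^sub>C perm_act p v)"

lemma perm_act_point:
  assumes "p permutes S"
  shows "perm_act p (point T) = point (\<lambda>i. p ` T i)"
proof -
  have bij: "bij p" using assms by (rule permutes_bij)
  have "(\<lambda>i. inv p ` U i) = T \<longleftrightarrow> U = (\<lambda>i. p ` T i)" for U :: "nat \<Rightarrow> nat set"
  proof
    assume "(\<lambda>i. inv p ` U i) = T"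
    then have "(\<lambda>i. p ` T i) = (\<lambda>i. p ` inv p ` U i)" by auto
    also have "\<dots> = U" using bij by (simp add: image_f_inv_f bij_is_surj)
    finally show "U = (\<lambda>i. p ` T i)" by simp
  next
    assume "U = (\<lambda>i. p ` T i)"
    then show "(\<lambda>i. inv p ` U i) = T" using bij by (simp add: image_inv_f_f bij_is_inj)
  qed
  then show ?thesis by (auto simp: perm_act_def point_def fun_eq_iff)
qed

lemma linear_perm_act: "Vector_Spaces.linear cscale cscale (perm_act p)"
  by unfold_locales (auto simp: perm_act_def cscale_def fun_eq_iff algebra_simps)

lemma linear_group_algebra_act:
  "Vector_Spaces.linear cscale cscale (group_algebra_act n a)"
proof -
  interpret pa: Vector_Spaces.linear cscale cscale "perm_act p" for p by (rule linear_perm_act)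
  show ?thesis
    by unfold_locales
      (auto simp: group_algebra_act_def pa.add pa.scale cfun.scale_right_distrib sum.distrib
        cfun.scale_sum_right mult.commute)
qed

lemma perm_act_polytabloid:
  assumes p: "p permutes {1..psize lam}"
  shows "perm_act p (polytabloid lam t) = polytabloid lam (p \<circ> t)"
proof -
  let ?C = "column_stabilizer lam"
  let ?c = "\<lambda>q. p \<circ> q \<circ> inv p"
  interpret pa: Vector_Spaces.linear cscale cscale "perm_act p" by (rule linear_perm_act)
  have inj: "inj p" and bij: "bij p"
    using p by (auto intro: permutes_inj permutes_bij)
  have ip: "inv p permutes {1..psize lam}" using p by (rule permutes_inv)
  have col: "tableau_column lam (p \<circ> s) j = p ` tableau_column lam s j" for s j and p :: "nat \<Rightarrow> nat"
    by (auto simp: tableau_column_def)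
  have tab: "tabloid lam (p \<circ> s) = (\<lambda>i. p ` tabloid lam s i)" for s
    by (auto simp: tabloid_def)
  have conj: "p \<circ> q \<circ> inv p \<in> ?C (p \<circ> s)"
    if q: "q \<in> ?C s" and p: "p permutes {1..psize lam}" for p q s
  proof -
    have "(p \<circ> q \<circ> inv p) ` p ` A = p ` q ` A" for A
      using permutes_inj[OF p] by (simp add: image_image)
    moreover have "p \<circ> q \<circ> inv p permutes {1..psize lam}"
      using q p by (auto simp: column_stabilizer_def intro: permutes_compose permutes_inv)
    ultimately show ?thesis using q by (auto simp: column_stabilizer_def col)
  qed
  have bk: "inv p \<circ> q \<circ> p \<in> ?C t" if q: "q \<in> ?C (p \<circ> t)" for q
  proof -
    have "inv p \<circ> (p \<circ> t) = t" using inj by (simp add: fun_eq_iff)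
    moreover have "inv (inv p) = p" using bij by (rule inv_inv_eq)
    ultimately show ?thesis using conj[OF q ip] by simp
  qed
  have sgn: "sign (?c q) = sign q" if "q \<in> ?C t" for q
  proof -
    have "permutation q" "permutation p" "permutation (inv p)"
      using that p ip by (auto simp: column_stabilizer_def permutation_permutes)
    then show ?thesis by (simp add: sign_compose sign_inverse permutation_compose sign_idempotent)
  qed
  have "perm_act p (polytabloid lam t) =
      (\<Sum>q\<in>?C t. of_int (sign q) *\<^sub>C point (tabloid lam (p \<circ> (q \<circ> t))))"
    by (simp add: polytabloid_def pa.sum pa.scale perm_act_point[OF p] tab)
  also have "\<dots> = (\<Sum>q\<in>?C (p \<circ> t). of_int (sign q) *\<^sub>C point (tabloid lam (q \<circ> (p \<circ> t))))"
  proof (rule sum.reindex_bij_witness[where i = "\<lambda>q. inv p \<circ> q \<circ> p" and j = ?c])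
    fix q assume q: "q \<in> ?C t"
    show "inv p \<circ> ?c q \<circ> p = q" using inj by (simp add: fun_eq_iff)
    show "?c q \<in> ?C (p \<circ> t)" using conj[OF q p] .
    have "?c q \<circ> (p \<circ> t) = p \<circ> (q \<circ> t)" using inj by (simp add: fun_eq_iff)
    then show "of_int (sign (?c q)) *\<^sub>C point (tabloid lam (?c q \<circ> (p \<circ> t))) =
        of_int (sign q) *\<^sub>C point (tabloid lam (p \<circ> (q \<circ> t)))"
      by (simp only: sgn[OF q])
  next
    fix q assume q: "q \<in> ?C (p \<circ> t)"
    show "inv p \<circ> q \<circ> p \<in> ?C t" using bk[OF q] .
    show "?c (inv p \<circ> q \<circ> p) = q"
      using bij by (simp add: fun_eq_iff surj_f_inv_f bij_is_surj)
  qed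
  finally show ?thesis by (simp add: polytabloid_def)
qed

lemma perm_act_specht:
  assumes p: "p permutes {1..psize lam}" and v: "v \<in> specht lam"
  shows "perm_act p v \<in> specht lam"
proof -
  interpret pa: Vector_Spaces.linear cscale cscale "perm_act p" by (rule linear_perm_act)
  have "perm_act p ` specht lam = cfun.span (perm_act p ` {polytabloid lam t | t. tableau lam t})"
    unfolding specht_def by (rule pa.span_image[symmetric])
  also have "\<dots> \<subseteq> specht lam"
    unfolding specht_def
  proof (rule cfun.span_mono)
    have "tableau lam (p \<circ> t)" if "tableau lam t" for t
      using that bij_betw_trans[OF _ permutes_imp_bij[OF p]] by (auto simp: tableau_def)
    then show "perm_act p ` {polytabloid lam t | t. tableau lam t}
        \<subseteq> {polytabloid lam t | t. tableau lam t}"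
      by (auto simp: perm_act_polytabloid[OF p])
  qed
  finally show ?thesis using v by blast
qed

lemma group_algebra_act_specht:
  assumes "v \<in> specht lam"
  shows "group_algebra_act (psize lam) a v \<in> specht lam"
  unfolding group_algebra_act_def
  using perm_act_specht[OF _ assms]
  by (auto simp: specht_def intro!: cfun.span_sum cfun.span_scale)


section \<open>Inner products and operators on a subspace\<close>

text \<open>Inner products are linear in the first argument; only their values on \<open>V\<close> matter.\<close>

definition inner_product_on ::
    "('t \<Rightarrow> complex) set \<Rightarrow> (('t \<Rightarrow> complex) \<Rightarrow> ('t \<Rightarrow> complex) \<Rightarrow> complex) \<Rightarrow> bool"
  where "inner_product_on V ip \<longleftrightarrow>
    (\<forall>u\<in>V. \<forall>v\<in>V. \<forall>w\<in>V. ip (u + v) w = ip u w + ip v w) \<and>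
    (\<forall>c. \<forall>v\<in>V. \<forall>w\<in>V. ip (c *\<^sub>C v) w = c * ip v w) \<and>
    (\<forall>v\<in>V. \<forall>w\<in>V. ip v w = cnj (ip w v)) \<and>
    (\<forall>v\<in>V. v \<noteq> 0 \<longrightarrow> 0 < Re (ip v v))"

definition unitary_on ::
    "('t \<Rightarrow> complex) set \<Rightarrow> (('t \<Rightarrow> complex) \<Rightarrow> ('t \<Rightarrow> complex) \<Rightarrow> complex) \<Rightarrow>
     (('t \<Rightarrow> complex) \<Rightarrow> 't \<Rightarrow> complex) \<Rightarrow> bool"
  where "unitary_on V ip A \<longleftrightarrow>
    A ` V = V \<and> (\<forall>v\<in>V. \<forall>w\<in>V. ip (A v) (A w) = ip v w)"

definition self_adjoint_on ::
    "('t \<Rightarrow> complex) set \<Rightarrow> (('t \<Rightarrow> complex) \<Rightarrow> ('t \<Rightarrow> complex) \<Rightarrow> complex) \<Rightarrow>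
     (('t \<Rightarrow> complex) \<Rightarrow> 't \<Rightarrow> complex) \<Rightarrow> bool"
  where "self_adjoint_on V ip A \<longleftrightarrow>
    A ` V \<subseteq> V \<and> (\<forall>v\<in>V. \<forall>w\<in>V. ip (A v) w = ip v (A w))"

text \<open>Self-adjointness makes \<open>ip (A v) v\<close> real.\<close>

definition positive_semidefinite_on ::
    "('t \<Rightarrow> complex) set \<Rightarrow> (('t \<Rightarrow> complex) \<Rightarrow> ('t \<Rightarrow> complex) \<Rightarrow> complex) \<Rightarrow>
     (('t \<Rightarrow> complex) \<Rightarrow> 't \<Rightarrow> complex) \<Rightarrow> bool"
  where "positive_semidefinite_on V ip A \<longleftrightarrow>
    self_adjoint_on V ip A \<and> (\<forall>v\<in>V. 0 \<le> Re (ip (A v) v))"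

definition positive_definite_on ::
    "('t \<Rightarrow> complex) set \<Rightarrow> (('t \<Rightarrow> complex) \<Rightarrow> ('t \<Rightarrow> complex) \<Rightarrow> complex) \<Rightarrow>
     (('t \<Rightarrow> complex) \<Rightarrow> 't \<Rightarrow> complex) \<Rightarrow> bool"
  where "positive_definite_on V ip A \<longleftrightarrow>
    self_adjoint_on V ip A \<and> (\<forall>v\<in>V. v \<noteq> 0 \<longrightarrow> 0 < Re (ip (A v) v))"

end

theory Submission
  imports Defs
begin

text \<open>
  The operator \<open>\<beta>\<close> is the sum over \<open>X\<close> of the operators \<open>e\<^sub>X = \<Sum>p. \<chi>(p) p\<close>, \<open>p\<close> running through the
  permutations of \<open>X\<close>, with the products of the \<open>z i\<close> as coefficients.  It therefore suffices to show
  that each \<open>e\<^sub>X\<close> is self-adjoint and positive semidefinite, that it vanishes if \<open>lam\<close> is not contained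
  in \<open>nu\<close>, and that otherwise no nonzero vector lies in the kernels of all \<open>e\<^sub>X\<close>.  Up to a positive
  factor, \<open>e\<^sub>X\<close> is an isotypic projection, and the claims are usually read off from Schur's lemma, the
  irreducibility of Specht modules and the branching rule.  The proof below replaces these by direct
  arguments with Young symmetrizers.

  Positivity: both \<open>\<chi>(p)\<close> and \<open>\<langle>p v, v\<rangle>\<close> are positive definite functions of \<open>p\<close>, hence so is their
  product, and the sum of a positive definite function over a finite group is nonnegative.  In detail, the
  lemma \<open>char_act_gram\<close> writes \<open>\<langle>e\<^sub>X v, w\<rangle>\<close>, up to a factor, as a sum of inner products of \<open>mixed_vector\<close>s of
  \<open>v\<close> and \<open>w\<close>.  Its diagonal vanishes only if all these vectors do, which by the lemma
  \<open>mixed_vector_polytabloid\<close> means that all Young symmetrizers of shape \<open>lam\<close> with entries in \<open>X\<close>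
  annihilate \<open>v\<close>.

  If \<open>lam\<close> is contained in \<open>nu\<close> and \<open>v\<close> is nonzero, some Young symmetrizer of shape \<open>lam\<close> does not
  annihilate \<open>v\<close> (\<open>exists_row_sum_column_antisym_nonzero\<close>): antisymmetrize \<open>v\<close> along the columns of a
  tableau of shape \<open>nu\<close> and use the part of that tableau inside \<open>lam\<close>.

  If \<open>lam\<close> is not contained in \<open>nu\<close>, every Young symmetrizer of shape \<open>lam\<close> annihilates the Specht module
  (\<open>row_sum_column_antisym_eq_0\<close>).  The argument is that by which one finds the highest weights of a tensor
  product of representations of the general linear group, in its Schur--Weyl dual form: elements of the
  Specht module are highest weight vectors, the leading term of such a vector with respect to a
  decomposition of the set of entries is again one, and for the decomposition into the rows of a filling
  of shape \<open>lam\<close> this forces row \<open>r\<close> of \<open>lam\<close> into row \<open>r\<close> of \<open>nu\<close>.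
\<close>

section \<open>Traces through orthonormal systems\<close>

text \<open>A finite orthonormal spanning set has this property, which is all that computing traces
  requires of it.\<close>

definition expansion_system ::
    "('t \<Rightarrow> complex) set \<Rightarrow> (('t \<Rightarrow> complex) \<Rightarrow> ('t \<Rightarrow> complex) \<Rightarrow> complex) \<Rightarrow> ('t \<Rightarrow> complex) set \<Rightarrow> bool"
  where "expansion_system V ip B \<longleftrightarrow>
    finite B \<and> B \<subseteq> V \<and> (\<forall>x\<in>V. x = (\<Sum>b\<in>B. ip x b *\<^sub>C b))"

locale inner_product_subspace =
  fixes V :: "('t \<Rightarrow> complex) set"
    and ip :: "('t \<Rightarrow> complex) \<Rightarrow> ('t \<Rightarrow> complex) \<Rightarrow> complex"
  assumes subspace: "cfun.subspace V"
    and inner: "inner_product_on V ip"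
begin

lemma ip_add_left: "u \<in> V \<Longrightarrow> v \<in> V \<Longrightarrow> w \<in> V \<Longrightarrow> ip (u + v) w = ip u w + ip v w"
  and ip_scale_left: "v \<in> V \<Longrightarrow> w \<in> V \<Longrightarrow> ip (c *\<^sub>C v) w = c * ip v w"
  and ip_commute: "v \<in> V \<Longrightarrow> w \<in> V \<Longrightarrow> ip v w = cnj (ip w v)"
  and ip_pos: "v \<in> V \<Longrightarrow> v \<noteq> 0 \<Longrightarrow> 0 < Re (ip v v)"
  using inner unfolding inner_product_on_def by blast+

lemma sum_mem: "(\<And>i. i \<in> I \<Longrightarrow> g i \<in> V) \<Longrightarrow> sum g I \<in> V"
  using subspace by (rule cfun.subspace_sum)

lemma scale_mem: "v \<in> V \<Longrightarrow> c *\<^sub>C v \<in> V"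
  using subspace by (rule cfun.subspace_scale)

lemma ip_zero_left: "w \<in> V \<Longrightarrow> ip 0 w = 0"
  using ip_scale_left[of w w 0] by simp

lemma ip_self_nonneg: "v \<in> V \<Longrightarrow> 0 \<le> Re (ip v v)"
  using ip_pos[of v] ip_zero_left[of v] by (cases "v = 0") auto

lemma ip_self_eq_0_iff: "v \<in> V \<Longrightarrow> Re (ip v v) = 0 \<longleftrightarrow> v = 0"
  using ip_pos[of v] ip_zero_left[of v] by (cases "v = 0") auto

lemma ip_self_real: "v \<in> V \<Longrightarrow> ip v v \<in> \<real>"
  by (metis ip_commute Reals_cnj_iff)

lemma ip_sum_left:
  assumes "\<And>i. i \<in> I \<Longrightarrow> g i \<in> V" "w \<in> V"
  shows "ip (sum g I) w = (\<Sum>i\<in>I. ip (g i) w)"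
  using assms
  by (induction I rule: infinite_finite_induct)
    (auto simp: ip_zero_left ip_add_left sum_mem)

lemma ip_sum_right:
  assumes "\<And>i. i \<in> I \<Longrightarrow> g i \<in> V" "w \<in> V"
  shows "ip w (sum g I) = (\<Sum>i\<in>I. ip w (g i))"
proof -
  have "ip w (sum g I) = cnj (\<Sum>i\<in>I. ip (g i) w)"
    using assms by (subst ip_commute) (auto simp: ip_sum_left sum_mem)
  also have "\<dots> = (\<Sum>i\<in>I. ip w (g i))"
    unfolding cnj_sum using assms by (intro sum.cong refl ip_commute[symmetric]) auto
  finally show ?thesis .
qed

lemma ip_scale_right: "v \<in> V \<Longrightarrow> w \<in> V \<Longrightarrow> ip w (c *\<^sub>C v) = cnj c * ip w v"
  using ip_commute[of w "c *\<^sub>C v"] ip_commute[of w v] by (simp add: ip_scale_left scale_mem)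

lemma ip_sum_sum:
  assumes "\<And>i. i \<in> I \<Longrightarrow> g i \<in> V" "\<And>j. j \<in> J \<Longrightarrow> h j \<in> V"
  shows "ip (\<Sum>i\<in>I. a i *\<^sub>C g i) (\<Sum>j\<in>J. b j *\<^sub>C h j) =
    (\<Sum>i\<in>I. \<Sum>j\<in>J. a i * cnj (b j) * ip (g i) (h j))"
proof -
  have "ip (\<Sum>i\<in>I. a i *\<^sub>C g i) (\<Sum>j\<in>J. b j *\<^sub>C h j) =
      (\<Sum>i\<in>I. ip (a i *\<^sub>C g i) (\<Sum>j\<in>J. b j *\<^sub>C h j))"
    by (rule ip_sum_left) (auto simp: assms scale_mem intro!: sum_mem)
  also have "\<dots> = (\<Sum>i\<in>I. \<Sum>j\<in>J. ip (a i *\<^sub>C g i) (b j *\<^sub>C h j))"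
    by (intro sum.cong refl ip_sum_right) (auto simp: assms scale_mem)
  also have "\<dots> = (\<Sum>i\<in>I. \<Sum>j\<in>J. a i * cnj (b j) * ip (g i) (h j))"
    by (intro sum.cong refl) (auto simp: assms scale_mem ip_scale_left ip_scale_right)
  finally show ?thesis .
qed

text \<open>The Gram--Schmidt process, adding one spanning vector at a time.\<close>

lemma exists_expansion_system_span:
  assumes "finite S" "cfun.span S \<subseteq> V"
  shows "\<exists>B. expansion_system (cfun.span S) ip B"
  using assms
proof (induction S rule: finite_induct)
  case empty
  show ?case by (intro exI[of _ "{}"]) (auto simp: expansion_system_def)
next
  case (insert a S)
  have sub: "cfun.span S \<subseteq> cfun.span (insert a S)"
    by (intro cfun.span_mono) auto
  with insert obtain B where B: "finite B" "B \<subseteq> cfun.span S"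
    and expand: "\<And>x. x \<in> cfun.span S \<Longrightarrow> x = (\<Sum>b\<in>B. ip x b *\<^sub>C b)"
    unfolding expansion_system_def by (metis subset_trans)
  have SV: "cfun.span S \<subseteq> V" and aV: "a \<in> V"
    using insert.prems sub by (auto intro: cfun.span_base)
  define pr where "pr = (\<Sum>b\<in>B. ip a b *\<^sub>C b)"
  have pr: "pr \<in> cfun.span S"
    unfolding pr_def using B by (auto intro!: cfun.span_sum cfun.span_scale)
  define a' where "a' = a - pr"
  have a'V: "a' \<in> V" unfolding a'_def
    using aV pr SV subspace by (auto intro: cfun.subspace_diff)
  have a': "a' \<in> cfun.span (insert a S)" unfolding a'_def
    using pr sub by (auto intro!: cfun.span_diff intro: cfun.span_base)
  have a_eq: "a = a' + pr" by (simp add: a'_def)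
  have orth: "ip a' x = 0" if x: "x \<in> cfun.span S" for x
  proof -
    have BV: "\<And>b. b \<in> B \<Longrightarrow> b \<in> V" and xV: "x \<in> V" using B SV x by auto
    have "ip pr x = (\<Sum>b\<in>B. ip a b * ip b x)"
      unfolding pr_def using BV xV by (subst ip_sum_left) (auto simp: scale_mem ip_scale_left)
    also have "\<dots> = (\<Sum>b\<in>B. ip a (ip x b *\<^sub>C b))"
      using BV xV aV by (intro sum.cong refl) (simp add: ip_scale_right, metis ip_commute mult.commute)
    also have "\<dots> = ip a (\<Sum>b\<in>B. ip x b *\<^sub>C b)"
      using BV aV by (subst ip_sum_right) (auto simp: scale_mem)
    also have "\<dots> = ip a x" using expand[OF x] by simp
    finally have "ip pr x = ip a x" .
    moreover have "ip a x = ip a' x + ip pr x"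
      using a'V pr SV xV by (subst a_eq) (auto simp: ip_add_left)
    ultimately show ?thesis by simp
  qed
  show ?case
  proof (cases "a' = 0")
    case True
    then have "a \<in> cfun.span S" using pr a_eq by simp
    then have "cfun.span (insert a S) = cfun.span S" by (rule cfun.span_redundant)
    then show ?thesis using B expand unfolding expansion_system_def by metis
  next
    case False
    define r where "r = Re (ip a' a')"
    have r: "0 < r" and ip_a': "ip a' a' = of_real r"
      using ip_pos[OF a'V False] ip_self_real[OF a'V] by (auto simp: r_def complex_is_Real_iff complex_eq_iff)
    define d where "d = complex_of_real (1 / sqrt r) *\<^sub>C a'"
    have dV: "d \<in> V" and d: "d \<in> cfun.span (insert a S)"
      unfolding d_def using a'V a' by (auto intro: scale_mem cfun.span_scale)
    have d_orth: "ip d x = 0" if "x \<in> cfun.span S" for x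
      unfolding d_def using orth[OF that] that SV a'V by (subst ip_scale_left) auto
    have "ip d d = 1"
      unfolding d_def using a'V r
      by (simp add: ip_scale_left ip_scale_right scale_mem ip_a' flip: of_real_mult)
    then have notin: "d \<notin> B" using d_orth[of d] B by auto
    have "x = (\<Sum>b\<in>insert d B. ip x b *\<^sub>C b)" if x: "x \<in> cfun.span (insert a S)" for x
    proof -
      obtain k where k: "x - k *\<^sub>C a \<in> cfun.span S"
        using x cfun.span_breakdown_eq[of x a S] by blast
      define y where "y = (x - k *\<^sub>C a) + k *\<^sub>C pr"
      have y: "y \<in> cfun.span S" unfolding y_def
        using k pr by (intro cfun.span_add cfun.span_scale)
      then have yV: "y \<in> V" using SV by auto
      have x_eq: "x = k *\<^sub>C a' + y" unfolding y_def a'_def by (simp add: cfun.scale_right_diff_distrib)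
      have ipx: "ip x z = k * ip a' z + ip y z" if "z \<in> V" for z
        unfolding x_eq using that a'V yV by (simp add: ip_add_left ip_scale_left scale_mem)
      have "ip y d = 0" using ip_commute[OF yV dV] d_orth[OF y] by simp
      then have "ip x d = k * complex_of_real (sqrt r)"
        using ipx[OF dV] a'V r unfolding d_def
        by (simp add: ip_scale_right ip_a' real_div_sqrt flip: of_real_mult of_real_divide)
      then have "ip x d *\<^sub>C d = k *\<^sub>C a'" unfolding d_def using r by simp
      moreover have "(\<Sum>b\<in>B. ip x b *\<^sub>C b) = (\<Sum>b\<in>B. ip y b *\<^sub>C b)"
      proof (intro sum.cong refl)
        fix b assume b: "b \<in> B"
        then have bS: "b \<in> cfun.span S" using B by blast
        then have "b \<in> V" using SV by blast
        then show "ip x b *\<^sub>C b = ip y b *\<^sub>C b" using ipx[of b] orth[OF bS] by simp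
      qed
      ultimately show ?thesis using x_eq expand[OF y] B notin by simp
    qed
    then show ?thesis
      using B d sub unfolding expansion_system_def by (intro exI[of _ "insert d B"]) blast
  qed
qed

lemma finite_basis:
  assumes "finite S" "V \<subseteq> cfun.span S"
  obtains D where "finite D" "D \<subseteq> V" "cfun.independent D" "cfun.span D = V"
proof -
  obtain D where D: "D \<subseteq> V" "cfun.independent D" "V \<subseteq> cfun.span D"
    by (rule cfun.maximal_independent_subset)
  then have "cfun.span D = V" using subspace cfun.span_minimal by blast
  moreover have "finite D" using cfun.independent_span_bound[of S D] assms D by auto
  ultimately show thesis using that D by blast
qed

lemma exists_expansion_system:
  assumes "finite S" "V \<subseteq> cfun.span S"
  shows "\<exists>B. expansion_system V ip B"
  by (rule finite_basis[OF assms]) (metis exists_expansion_system_span order_refl)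

text \<open>Let \<open>D\<close> be the basis that defines the trace and \<open>f\<close> its coordinate function.  Expanding
  \<open>d \<in> D\<close> along \<open>B\<close> writes the trace as the double sum of \<open>\<langle>d, b\<rangle> f (A b) d\<close>, and for a fixed \<open>b\<close> the sum
  over \<open>d\<close> collects \<open>A b\<close> again.\<close>

lemma trace_on_eq_sum_ip:
  assumes S: "finite S" "V \<subseteq> cfun.span S"
    and A: "Vector_Spaces.linear cscale cscale A" "\<And>v. v \<in> V \<Longrightarrow> A v \<in> V"
    and B_system: "expansion_system V ip B"
  shows "trace_on V A = (\<Sum>b\<in>B. ip (A b) b)"
proof -
  interpret A: Vector_Spaces.linear cscale cscale A by fact
  have B: "finite B" "B \<subseteq> V" "\<And>x. x \<in> V \<Longrightarrow> x = (\<Sum>b\<in>B. ip x b *\<^sub>C b)"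
    using B_system unfolding expansion_system_def by blast+
  let ?P = "\<lambda>D. D \<subseteq> V \<and> cfun.independent D \<and> cfun.span D = V"
  obtain D0 where "?P D0" using finite_basis[OF S] by metis
  define D where "D = (SOME D. ?P D)"
  have "?P D" unfolding D_def using \<open>?P D0\<close> by (rule someI[of ?P])
  then have D: "D \<subseteq> V" "cfun.independent D" "cfun.span D = V" by auto
  have finD: "finite D" using cfun.independent_span_bound[of S D] S D by auto
  define f where "f = cfun.representation D"
  have f_sum: "f (sum g I) d = (\<Sum>i\<in>I. f (g i) d)" if "\<And>i. i \<in> I \<Longrightarrow> g i \<in> V" for g :: "_ \<Rightarrow> _" and I d
    unfolding f_def using that D by (subst cfun.representation_sum) auto
  have f_scale: "f (c *\<^sub>C v) d = c * f v d" if "v \<in> V" for c v d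
    unfolding f_def using that D by (subst cfun.representation_scale) auto
  have f_expand: "(\<Sum>d\<in>D. f v d *\<^sub>C d) = v" if "v \<in> V" for v
    unfolding f_def using that D finD by (intro cfun.sum_representation_eq) auto
  have BV: "b \<in> V" if "b \<in> B" for b using that B by auto
  have DV: "d \<in> V" if "d \<in> D" for d using that D by auto
  have "trace_on V A = (\<Sum>d\<in>D. f (A d) d)"
    by (simp add: trace_on_def D_def f_def Let_def)
  also have "\<dots> = (\<Sum>d\<in>D. \<Sum>b\<in>B. ip d b * f (A b) d)"
  proof (intro sum.cong refl)
    fix d assume "d \<in> D"
    then have "A d = A (\<Sum>b\<in>B. ip d b *\<^sub>C b)" using B(3)[of d] D by auto
    also have "\<dots> = (\<Sum>b\<in>B. ip d b *\<^sub>C A b)" by (simp add: A.sum A.scale)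
    finally have "A d = (\<Sum>b\<in>B. ip d b *\<^sub>C A b)" .
    then show "f (A d) d = (\<Sum>b\<in>B. ip d b * f (A b) d)"
      using BV A(2) by (simp add: f_sum f_scale scale_mem)
  qed
  also have "\<dots> = (\<Sum>b\<in>B. \<Sum>d\<in>D. ip (f (A b) d *\<^sub>C d) b)"
    using DV BV by (subst sum.swap) (auto intro!: sum.cong simp: ip_scale_left mult.commute)
  also have "\<dots> = (\<Sum>b\<in>B. ip (\<Sum>d\<in>D. f (A b) d *\<^sub>C d) b)"
    using DV BV by (intro sum.cong refl, subst ip_sum_left) (auto simp: scale_mem)
  also have "\<dots> = (\<Sum>b\<in>B. ip (A b) b)"
    using BV A(2) by (simp add: f_expand)
  finally show ?thesis .
qed

end

section \<open>Tabloids as words\<close>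

lemma sum_fun_apply: "(\<Sum>i\<in>I. g i) x = (\<Sum>i\<in>I. g i x)"
  by (induction I rule: infinite_finite_induct) auto

lemma perm_act_compose:
  assumes "bij p" "bij q"
  shows "perm_act p (perm_act q v) = perm_act (p \<circ> q) v"
  using assms by (simp add: perm_act_def o_inv_distrib image_comp fun_eq_iff)

lemma perm_act_sum: "perm_act p (sum g I) = (\<Sum>i\<in>I. perm_act p (g i))"
  and perm_act_scale: "perm_act p (c *\<^sub>C v) = c *\<^sub>C perm_act p v"
  by (simp_all add: perm_act_def fun_eq_iff sum_fun_apply cscale_def)

text \<open>A tabloid with entries \<open>1, \<dots>, n\<close> is encoded by the word that sends each entry to the index
  of its row.  Changing the row of one entry is then a function update.\<close>

definition row_sets :: "nat \<Rightarrow> (nat \<Rightarrow> nat) \<Rightarrow> nat \<Rightarrow> nat set"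
  where "row_sets n s = (\<lambda>i. {x \<in> {1..n}. s x = i})"

lemma perm_act_row_sets:
  assumes p: "p permutes {1..n}"
  shows "perm_act p v (row_sets n s) = v (row_sets n (s \<circ> p))"
proof -
  have "inv p ` row_sets n s i = row_sets n (s \<circ> p) i" for i
  proof (intro set_eqI iffI)
    fix x assume "x \<in> inv p ` row_sets n s i"
    then show "x \<in> row_sets n (s \<circ> p) i"
      using permutes_in_image[OF permutes_inv[OF p]] permutes_inverses(1)[OF p]
      by (auto simp: row_sets_def)
  next
    fix x assume "x \<in> row_sets n (s \<circ> p) i"
    then have "p x \<in> row_sets n s i"
      using permutes_in_image[OF p] by (auto simp: row_sets_def)
    then show "x \<in> inv p ` row_sets n s i"
      using permutes_inverses(2)[OF p] by (metis imageI)
  qed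
  then show ?thesis by (simp add: perm_act_def)
qed

lemma row_sets_eq_tabloid_iff:
  assumes "tableau nu t"
  shows "row_sets (psize nu) s = tabloid nu t \<longleftrightarrow> (\<forall>(i, j)\<in>diagram nu. s (t (i, j)) = i)"
proof
  assume eq: "row_sets (psize nu) s = tabloid nu t"
  have "s (t (i, j)) = i" if "(i, j) \<in> diagram nu" for i j
  proof -
    have "t (i, j) \<in> tabloid nu t i" using that by (auto simp: tabloid_def)
    then show ?thesis by (auto simp: row_sets_def simp flip: eq)
  qed
  then show "\<forall>(i, j)\<in>diagram nu. s (t (i, j)) = i" by auto
next
  assume s: "\<forall>(i, j)\<in>diagram nu. s (t (i, j)) = i"
  have im: "t ` diagram nu = {1..psize nu}" using assms by (auto simp: tableau_def bij_betw_def)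
  show "row_sets (psize nu) s = tabloid nu t"
  proof (intro ext set_eqI iffI)
    fix i x assume "x \<in> row_sets (psize nu) s i"
    then have x: "x \<in> t ` diagram nu" "s x = i" by (auto simp: row_sets_def im)
    then obtain i' j where d: "(i', j) \<in> diagram nu" "x = t (i', j)" by auto
    then have "i' = i" using x(2) s by auto
    then show "x \<in> tabloid nu t i" using d by (auto simp: tabloid_def)
  next
    fix i x assume "x \<in> tabloid nu t i"
    then obtain j where j: "(i, j) \<in> diagram nu" "x = t (i, j)" by (auto simp: tabloid_def)
    then have "x \<in> {1..psize nu}" using im by blast
    then show "x \<in> row_sets (psize nu) s i" using j s by (auto simp: row_sets_def)
  qed
qed

lemma tabloid_eq_row_sets:
  assumes "tableau nu t"
  shows "tabloid nu t = row_sets (psize nu) (\<lambda>x. fst (inv_into (diagram nu) t x))"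
proof -
  have "inj_on t (diagram nu)" using assms by (simp add: tableau_def bij_betw_def)
  then have "\<forall>(i, j)\<in>diagram nu. fst (inv_into (diagram nu) t (t (i, j))) = i"
    by (auto simp: inv_into_f_f)
  then show ?thesis by (rule row_sets_eq_tabloid_iff[OF assms, THEN iffD2, symmetric])
qed

lemma tableau_perm: "tableau lam t \<Longrightarrow> p permutes {1..psize lam} \<Longrightarrow> tableau lam (p \<circ> t)"
  unfolding tableau_def by (rule bij_betw_trans[OF _ permutes_imp_bij])

lemma tabloid_comp: "tabloid lam (q \<circ> s) = (\<lambda>i. q ` tabloid lam s i)"
  by (auto simp: tabloid_def)

lemma tableau_column_comp: "tableau_column lam (q \<circ> s) j = q ` tableau_column lam s j"
  by (auto simp: tableau_column_def)

lemma column_stabilizer_permutes: "p \<in> column_stabilizer nu t \<Longrightarrow> p permutes {1..psize nu}"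
  by (simp add: column_stabilizer_def)

lemma polytabloid_apply:
  "polytabloid lam t T =
    (\<Sum>p\<in>column_stabilizer lam t. of_int (sign p) * (if T = tabloid lam (p \<circ> t) then 1 else 0))"
  by (simp add: polytabloid_def sum_fun_apply cscale_def point_def)

lemma specht_induct [consumes 1, case_names polytabloid zero add scale]:
  assumes "v \<in> specht nu"
    and "\<And>t. tableau nu t \<Longrightarrow> P (polytabloid nu t)"
    and "P 0" "\<And>u v. P u \<Longrightarrow> P v \<Longrightarrow> P (u + v)" "\<And>c v. P v \<Longrightarrow> P (c *\<^sub>C v)"
  shows "P v"
proof -
  have "cfun.subspace (Collect P)"
    by (rule cfun.subspaceI) (simp_all only: mem_Collect_eq assms(3-5))
  with assms(1)[unfolded specht_def] show ?thesis
    by (rule cfun.span_induct) (auto simp only: mem_Collect_eq intro: assms(2))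
qed

lemma polytabloid_in_specht: "tableau nu t \<Longrightarrow> polytabloid nu t \<in> specht nu"
  unfolding specht_def by (rule cfun.span_base) blast

lemma specht_support:
  assumes "v \<in> specht nu" "v T \<noteq> 0"
  shows "\<exists>t. tableau nu t \<and> T = tabloid nu t"
proof (rule ccontr)
  assume no: "\<nexists>t. tableau nu t \<and> T = tabloid nu t"
  have "v T = 0" using assms(1)
  proof (induction rule: specht_induct)
    case (polytabloid t)
    have "T \<noteq> tabloid nu (p \<circ> t)" if "p \<in> column_stabilizer nu t" for p
      using no tableau_perm[OF polytabloid column_stabilizer_permutes[OF that]] by blast
    then show ?case unfolding polytabloid_apply by (intro sum.neutral) simp
  qed (simp_all add: cscale_def)
  with assms(2) show False by simp
qed

text \<open>Besides tableaux, fillings with entries in a subset \<open>X\<close> of \<open>{1..n}\<close> occur, since \<open>\<beta>\<close> is composed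
  of permutations of such subsets.\<close>

definition column_group :: "(nat \<Rightarrow> nat) \<Rightarrow> nat set \<Rightarrow> (nat \<times> nat \<Rightarrow> nat) \<Rightarrow> (nat \<Rightarrow> nat) set"
  where "column_group lam X t =
    {p. p permutes X \<and> (\<forall>j. p ` tableau_column lam t j = tableau_column lam t j)}"

lemma column_stabilizer_eq: "column_stabilizer lam t = column_group lam {1..psize lam} t"
  by (simp add: column_stabilizer_def column_group_def)

lemma column_group_permutes: "p \<in> column_group lam X t \<Longrightarrow> p permutes X"
  by (simp add: column_group_def)

lemma finite_column_group: "finite X \<Longrightarrow> finite (column_group lam X t)"
  unfolding column_group_def by (rule finite_subset[OF _ finite_permutations[of X]]) auto

lemma id_in_column_group: "id \<in> column_group lam X t"
  by (simp add: column_group_def permutes_id)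

lemma compose_in_column_group:
  assumes "p \<in> column_group lam X t" "q \<in> column_group lam X t"
  shows "p \<circ> q \<in> column_group lam X t"
proof -
  have "(p \<circ> q) ` A = p ` q ` A" for A by (simp add: image_comp)
  then show ?thesis using assms unfolding column_group_def
    by (simp only: mem_Collect_eq permutes_compose simp_thms)
qed

lemma inv_in_column_group:
  assumes p: "p \<in> column_group lam X t"
  shows "inv p \<in> column_group lam X t"
proof -
  have "inv p ` tableau_column lam t j = tableau_column lam t j" for j
  proof -
    have "inv p ` p ` tableau_column lam t j = tableau_column lam t j"
      using permutes_inj[OF column_group_permutes[OF p]] by (rule image_inv_f_f)
    then show ?thesis using p by (simp add: column_group_def)
  qed
  then show ?thesis using permutes_inv[OF column_group_permutes[OF p]] by (simp add: column_group_def)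
qed

lemma transpose_in_column_group:
  assumes t: "bij_betw t (diagram lam) X" and c: "(i, j) \<in> diagram lam" "(i', j) \<in> diagram lam"
  shows "Transposition.transpose (t (i, j)) (t (i', j)) \<in> column_group lam X t" (is "?q \<in> _")
proof -
  have im: "t ` diagram lam = X" and inj: "inj_on t (diagram lam)"
    using t by (auto simp: bij_betw_def)
  have "?q permutes X" using c im by (intro permutes_swap_id) blast+
  moreover have "?q ` tableau_column lam t j' = tableau_column lam t j'" for j'
  proof (cases "j' = j")
    case True
    then have "t (i, j) \<in> tableau_column lam t j'" "t (i', j) \<in> tableau_column lam t j'"
      using c by (auto simp: tableau_column_def)
    then show ?thesis by (simp add: transpose_image_eq)
  next
    case False
    then have "t (i, j) \<notin> tableau_column lam t j'" "t (i', j) \<notin> tableau_column lam t j'"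
      using c by (auto simp: tableau_column_def inj_on_eq_iff[OF inj])
    then show ?thesis by (simp add: transpose_image_eq)
  qed
  ultimately show ?thesis by (simp add: column_group_def)
qed

text \<open>This is one of James's kernel conditions.  Let the operator \<open>E\<^sub>i\<close> move, in all possible ways, one
  entry from row \<open>Suc i\<close> to row \<open>i\<close>; the sum is the coefficient of \<open>E\<^sub>i v\<close> at the word \<open>s\<close>, and the
  vectors of a Specht module are highest weight vectors in the sense that all \<open>E\<^sub>i\<close> annihilate them.
  For the polytabloid of \<open>t\<close> the terms cancel in pairs: the entry \<open>y\<close> sits in a cell \<open>(Suc i, j)\<close> of
  \<open>p \<circ> t\<close>, while \<open>s\<close> places both \<open>y\<close> and the entry of the cell \<open>(i, j)\<close> in row \<open>i\<close>.  Exchanging these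
  two entries of column \<open>j\<close> gives another term of the sum, with the opposite sign.\<close>

lemma specht_raising_eq_0:
  assumes nu: "antimono nu" and v: "v \<in> specht nu"
  shows "(\<Sum>y | y \<in> {1..psize nu} \<and> s y = i. v (row_sets (psize nu) (s(y := Suc i)))) = 0"
  using v
proof (induction rule: specht_induct)
  case (polytabloid t)
  let ?C = "column_stabilizer nu t" and ?n = "psize nu"
  have bij: "bij_betw t (diagram nu) {1..?n}" using polytabloid by (simp add: tableau_def)
  then have inj: "inj_on t (diagram nu)" and im: "t ` diagram nu = {1..?n}"
    by (auto simp: bij_betw_def)
  define good where "good p d \<longleftrightarrow> s (p (t d)) = i \<and>
    (\<forall>(r, c)\<in>diagram nu. (s(p (t d) := Suc i)) (p (t (r, c))) = r)" for p d
  define g where "g p d = (of_int (sign p) * (if good p d then 1 else 0) :: complex)" for p d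
  have "(\<Sum>y | y \<in> {1..?n} \<and> s y = i. polytabloid nu t (row_sets ?n (s(y := Suc i)))) =
      (\<Sum>p\<in>?C. \<Sum>y | y \<in> {1..?n} \<and> s y = i. of_int (sign p) *
        (if row_sets ?n (s(y := Suc i)) = tabloid nu (p \<circ> t) then 1 else 0))"
    unfolding polytabloid_apply by (rule sum.swap)
  also have "\<dots> = (\<Sum>p\<in>?C. \<Sum>d\<in>diagram nu. g p d)"
  proof (intro sum.cong refl)
    fix p assume "p \<in> ?C"
    then have p: "p permutes {1..?n}" by (rule column_stabilizer_permutes)
    note iff = row_sets_eq_tabloid_iff[OF tableau_perm[OF polytabloid p]]
    have bij_pt: "bij_betw (\<lambda>d. p (t d)) (diagram nu) {1..?n}"
      using tableau_perm[OF polytabloid p] by (simp add: tableau_def comp_def)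
    have "(\<Sum>y | y \<in> {1..?n} \<and> s y = i. of_int (sign p) *
        (if row_sets ?n (s(y := Suc i)) = tabloid nu (p \<circ> t) then 1 else 0)) =
      (\<Sum>y\<in>{1..?n}. of_int (sign p) *
        (if s y = i \<and> (\<forall>(r, c)\<in>diagram nu. (s(y := Suc i)) (p (t (r, c))) = r) then 1 else 0) :: complex)"
      unfolding iff by (rule sum.mono_neutral_cong_left) auto
    also have "\<dots> = (\<Sum>d\<in>diagram nu. g p d)"
      unfolding g_def good_def by (rule sum.reindex_bij_betw[OF bij_pt, symmetric])
    finally show "(\<Sum>y | y \<in> {1..?n} \<and> s y = i. of_int (sign p) *
        (if row_sets ?n (s(y := Suc i)) = tabloid nu (p \<circ> t) then 1 else 0)) =
        (\<Sum>d\<in>diagram nu. g p d)" .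
  qed
  also have "\<dots> = (\<Sum>d\<in>diagram nu. \<Sum>p\<in>?C. g p d)" by (rule sum.swap)
  also have "\<dots> = 0"
  proof (rule sum.neutral, rule ballI)
    fix d assume d: "d \<in> diagram nu"
    obtain r c where rc: "d = (r, c)" by fastforce
    show "(\<Sum>p\<in>?C. g p d) = 0"
    proof cases
      assume False: "r \<noteq> Suc i"
      have "\<not> good p d" for p
        using d False unfolding good_def rc by auto
      then show ?thesis by (simp add: g_def)
    next
      assume "\<not> r \<noteq> Suc i"
      then have True: "r = Suc i" by simp
      define d' where "d' = (i, c)"
      have d': "d' \<in> diagram nu"
        using d nu True unfolding diagram_def rc d'_def by (auto dest: antimonoD[of nu i "Suc i"])
      have "d \<noteq> d'" using rc True by (simp add: d'_def)
      then have neq: "t d \<noteq> t d'" by (simp add: inj_on_eq_iff[OF inj d d'])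
      define q where "q = Transposition.transpose (t d) (t d')"
      have q: "q \<in> ?C" unfolding q_def
        using transpose_in_column_group[OF bij, of r c i] d d' by (simp add: rc d'_def column_stabilizer_eq)
      have qq: "q \<circ> q = id" unfolding q_def by simp
      have good_comp: "good (p \<circ> q) d" if good: "good p d" and p: "p permutes {1..?n}" for p
      proof -
        have inj_p: "p x = p y \<longleftrightarrow> x = y" for x y by (rule inj_eq[OF permutes_inj[OF p]])
        have s_d: "s (p (t d)) = i"
          and s_e: "\<And>r c. (r, c) \<in> diagram nu \<Longrightarrow> (s(p (t d) := Suc i)) (p (t (r, c))) = r"
          using good by (auto simp: good_def)
        have s_d': "s (p (t d')) = i"
          using s_e[of i c] d' neq inj_p by (simp add: d'_def)
        have "(s(p (t d') := Suc i)) (p (q (t (r', c')))) = r'" if e: "(r', c') \<in> diagram nu" for r' c'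
        proof -
          consider "(r', c') = d" | "(r', c') = d'" | "(r', c') \<noteq> d" "(r', c') \<noteq> d'" by blast
          then show ?thesis
          proof cases
            case 1 then show ?thesis using True rc by (simp add: q_def)
          next
            case 2 then show ?thesis using neq s_d inj_p by (simp add: q_def d'_def)
          next
            case 3
            then have "t (r', c') \<noteq> t d" "t (r', c') \<noteq> t d'"
              by (simp_all add: inj_on_eq_iff[OF inj e d] inj_on_eq_iff[OF inj e d'])
            then show ?thesis using s_e[OF e] inj_p by (simp add: q_def)
          qed
        qed
        then have "\<forall>(r', c')\<in>diagram nu. (s(p (t d') := Suc i)) (p (q (t (r', c')))) = r'" by blast
        moreover have "q (t d) = t d'" by (simp add: q_def)
        ultimately show ?thesis unfolding good_def comp_def using s_d' by simp
      qed
      have g_comp: "g (p \<circ> q) d = - g p d" if p: "p \<in> ?C" for p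
      proof -
        note pn = column_stabilizer_permutes[OF p] column_stabilizer_permutes[OF q]
        have "good (p \<circ> q) d \<longleftrightarrow> good p d"
        proof
          assume "good (p \<circ> q) d"
          then have "good (p \<circ> q \<circ> q) d" using permutes_compose[OF pn(2,1)] by (rule good_comp)
          then show "good p d" by (simp add: comp_assoc qq)
        qed (rule good_comp[OF _ pn(1)])
        moreover have "sign (p \<circ> q) = - sign p"
          using pn neq by (subst sign_compose) (auto simp: q_def sign_swap_id permutation_permutes)
        ultimately show ?thesis by (simp add: g_def)
      qed
      have C_comp: "p \<circ> q \<in> ?C" if "p \<in> ?C" for p
        using that q unfolding column_stabilizer_eq by (rule compose_in_column_group)
      have "(\<Sum>p\<in>?C. g p d) = (\<Sum>p\<in>?C. g (p \<circ> q) d)"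
        by (rule sum.reindex_bij_witness[where i = "\<lambda>p. p \<circ> q" and j = "\<lambda>p. p \<circ> q"])
          (auto simp: C_comp comp_assoc qq)
      also have "\<dots> = - (\<Sum>p\<in>?C. g p d)" by (simp add: g_comp sum_negf)
      finally show ?thesis by simp
    qed
  qed
  finally show ?case .
next
  case (scale c v)
  then show ?case by (simp only: cscale_def mult_zero_right flip: sum_distrib_left)
qed (simp_all add: sum.distrib)

section \<open>Young symmetrizers and containment of diagrams\<close>

definition column_antisym ::
    "(nat \<Rightarrow> nat) \<Rightarrow> nat set \<Rightarrow> (nat \<times> nat \<Rightarrow> nat) \<Rightarrow>
     ((nat \<Rightarrow> nat set) \<Rightarrow> complex) \<Rightarrow> (nat \<Rightarrow> nat set) \<Rightarrow> complex"
  where "column_antisym lam X t v = (\<Sum>p\<in>column_group lam X t. of_int (sign p) *\<^sub>C perm_act p v)"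

text \<open>If \<open>t\<close> and \<open>t'\<close> are bijections onto \<open>X\<close>, this is a left coset of the row stabilizer of \<open>t\<close>, and the
  row stabilizer itself for \<open>t' = t\<close>.\<close>

definition row_coset ::
    "(nat \<Rightarrow> nat) \<Rightarrow> nat set \<Rightarrow> (nat \<times> nat \<Rightarrow> nat) \<Rightarrow> (nat \<times> nat \<Rightarrow> nat) \<Rightarrow> (nat \<Rightarrow> nat) set"
  where "row_coset lam X t t' = {p. p permutes X \<and> tabloid lam (p \<circ> t) = tabloid lam t'}"

definition row_sum ::
    "(nat \<Rightarrow> nat) \<Rightarrow> nat set \<Rightarrow> (nat \<times> nat \<Rightarrow> nat) \<Rightarrow> (nat \<times> nat \<Rightarrow> nat) \<Rightarrow>
     ((nat \<Rightarrow> nat set) \<Rightarrow> complex) \<Rightarrow> (nat \<Rightarrow> nat set) \<Rightarrow> complex"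
  where "row_sum lam X t t' v = (\<Sum>p\<in>row_coset lam X t t'. perm_act p v)"

lemma column_antisym_sum:
  "column_antisym lam X t (\<Sum>i\<in>I. g i) = (\<Sum>i\<in>I. column_antisym lam X t (g i))"
  unfolding column_antisym_def perm_act_sum cfun.scale_sum_right by (rule sum.swap)

lemma column_antisym_scale:
  "column_antisym lam X t (c *\<^sub>C v) = c *\<^sub>C column_antisym lam X t v"
  unfolding column_antisym_def perm_act_scale cfun.scale_sum_right
  by (simp add: mult.commute)

lemma row_sum_sum: "row_sum lam X t t' (\<Sum>i\<in>I. g i) = (\<Sum>i\<in>I. row_sum lam X t t' (g i))"
  unfolding row_sum_def perm_act_sum by (rule sum.swap)

lemma row_sum_scale: "row_sum lam X t t' (c *\<^sub>C v) = c *\<^sub>C row_sum lam X t t' v"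
  unfolding row_sum_def perm_act_scale cfun.scale_sum_right ..

lemma perm_act_column_antisym:
  assumes q: "q \<in> column_group lam X t" and X: "finite X"
  shows "perm_act q (column_antisym lam X t v) = of_int (sign q) *\<^sub>C column_antisym lam X t v"
proof -
  let ?G = "column_group lam X t"
  have perm: "permutation p" "bij p" if "p \<in> ?G" for p
    using column_group_permutes[OF that] X permutes_bij by (auto simp: permutation_permutes)
  have "perm_act q (column_antisym lam X t v) =
      (\<Sum>p\<in>?G. of_int (sign p) *\<^sub>C perm_act (q \<circ> p) v)"
    unfolding column_antisym_def perm_act_sum perm_act_scale
    using perm q by (intro sum.cong refl) (simp add: perm_act_compose)
  also have "\<dots> = (\<Sum>p\<in>?G. of_int (sign (inv q \<circ> p)) *\<^sub>C perm_act p v)"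
  proof (rule sum.reindex_bij_witness[where i = "\<lambda>p. inv q \<circ> p" and j = "\<lambda>p. q \<circ> p"])
    fix p assume p: "p \<in> ?G"
    show *: "inv q \<circ> (q \<circ> p) = p" "q \<circ> (inv q \<circ> p) = p"
      using perm(2)[OF q] by (simp_all add: fun_eq_iff bij_is_inj bij_is_surj surj_f_inv_f)
    show "q \<circ> p \<in> ?G" using q p by (rule compose_in_column_group)
    show "inv q \<circ> p \<in> ?G" using inv_in_column_group[OF q] p by (rule compose_in_column_group)
    show "of_int (sign (inv q \<circ> (q \<circ> p))) *\<^sub>C perm_act (q \<circ> p) v =
        of_int (sign p) *\<^sub>C perm_act (q \<circ> p) v" unfolding * ..
  qed
  also have "\<dots> = of_int (sign q) *\<^sub>C column_antisym lam X t v"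
    unfolding column_antisym_def cfun.scale_sum_right
    using perm perm[OF inv_in_column_group[OF q]] perm[OF q]
    by (intro sum.cong refl) (simp add: sign_compose sign_inverse)
  finally show ?thesis .
qed

lemma perm_act_specht_on:
  assumes "p permutes X" "X \<subseteq> {1..psize nu}" "v \<in> specht nu"
  shows "perm_act p v \<in> specht nu"
  using perm_act_specht[OF permutes_subset[OF assms(1,2)] assms(3)] .

lemma subspace_specht: "cfun.subspace (specht nu)"
  by (simp add: specht_def)

lemma column_antisym_specht:
  assumes "X \<subseteq> {1..psize nu}" "v \<in> specht nu"
  shows "column_antisym lam X t v \<in> specht nu"
  unfolding column_antisym_def using assms column_group_permutes
  by (intro cfun.subspace_sum cfun.subspace_scale subspace_specht) (blast intro: perm_act_specht_on)

lemma row_sum_specht: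
  assumes "X \<subseteq> {1..psize nu}" "v \<in> specht nu"
  shows "row_sum lam X t t' v \<in> specht nu"
  unfolding row_sum_def using assms
  by (intro cfun.subspace_sum subspace_specht)
    (unfold row_coset_def mem_Collect_eq, blast intro: perm_act_specht_on)

subsection \<open>Highest weight functions on words\<close>

text \<open>The condition of the lemma \<open>specht_raising_eq_0\<close>, restricted to the entries in \<open>A\<close> and the
  rows from \<open>j\<close> on, while all other entries are kept in the rows that \<open>s0\<close> gives them.\<close>

definition highest_weight_at ::
    "((nat \<Rightarrow> nat) \<Rightarrow> complex) \<Rightarrow> nat set \<Rightarrow> nat \<Rightarrow> (nat \<Rightarrow> nat) \<Rightarrow> bool"
  where "highest_weight_at h A j s0 \<longleftrightarrow>
    (\<forall>s i. (\<forall>x. x \<notin> A \<longrightarrow> s x = s0 x) \<longrightarrow> j \<le> i \<longrightarrow> (\<Sum>y | y \<in> A \<and> s y = i. h (s(y := Suc i))) = 0)"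

text \<open>A function on \<open>A1 \<union> A2\<close> is a sum of functions on \<open>A1\<close>, indexed by the words on \<open>A2\<close>.  Take
  the component of a word on \<open>A2\<close> whose sum of row indices is maximal among those with a nonzero
  component.  Raising an entry of
  \<open>A2\<close> leads to this component only from words with a larger sum, where the function vanishes, so the
  component satisfies the highest weight condition by itself.\<close>

lemma highest_weight_restrict:
  assumes fin: "finite A1" "finite A2" and disj: "A1 \<inter> A2 = {}"
    and hw: "highest_weight_at h (A1 \<union> A2) j s0" and s0: "h s0 \<noteq> 0"
    and bound: "\<And>s x. h s \<noteq> 0 \<Longrightarrow> x \<in> A2 \<Longrightarrow> s x \<le> N"
  obtains s1 where "h s1 \<noteq> 0" "\<And>x. x \<notin> A1 \<union> A2 \<Longrightarrow> s1 x = s0 x" "highest_weight_at h A1 j s1"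
proof -
  define Q where "Q s \<longleftrightarrow> h s \<noteq> 0 \<and> (\<forall>x. x \<notin> A1 \<union> A2 \<longrightarrow> s x = s0 x)" for s
  have "\<exists>s. Q s \<and> (\<forall>s'. Q s' \<longrightarrow> sum s' A2 \<le> sum s A2)"
  proof (rule ex_has_greatest_nat)
    show "Q s0" using s0 by (simp add: Q_def)
    have "sum s A2 \<le> card A2 * N" if "Q s" for s
      using that bound sum_bounded_above[of A2 s N] by (simp add: Q_def)
    then show "\<forall>s. Q s \<longrightarrow> sum s A2 < Suc (card A2 * N)" by (simp add: less_Suc_eq_le)
  qed
  then obtain s1 where Q: "Q s1" and max: "\<And>s. Q s \<Longrightarrow> sum s A2 \<le> sum s1 A2" by blast
  have "highest_weight_at h A1 j s1"
    unfolding highest_weight_at_def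
  proof (intro allI impI)
    fix s i assume s: "\<forall>x. x \<notin> A1 \<longrightarrow> s x = s1 x" and i: "j \<le> i"
    have s_s0: "\<forall>x. x \<notin> A1 \<union> A2 \<longrightarrow> s x = s0 x" using s Q by (simp add: Q_def)
    have vanish: "h (s(y := Suc i)) = 0" if y: "y \<in> A2" "s y = i" for y
    proof (rule ccontr)
      assume "h (s(y := Suc i)) \<noteq> 0"
      then have "Q (s(y := Suc i))" using s_s0 y by (simp add: Q_def)
      then have "sum (s(y := Suc i)) A2 \<le> sum s1 A2" by (rule max)
      moreover have "sum s1 A2 = sum s A2" using s disj by (intro sum.cong) auto
      moreover have "sum (s(y := Suc i)) A2 = Suc (sum s A2)"
        using fin(2) y by (simp add: sum.remove[of A2 y])
      ultimately show False by simp
    qed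
    have "0 = (\<Sum>y | y \<in> A1 \<union> A2 \<and> s y = i. h (s(y := Suc i)))"
      using hw s_s0 i by (simp add: highest_weight_at_def)
    also have "\<dots> = (\<Sum>y | y \<in> A1 \<and> s y = i. h (s(y := Suc i)))"
      using fin vanish by (intro sum.mono_neutral_right) auto
    finally show "(\<Sum>y | y \<in> A1 \<and> s y = i. h (s(y := Suc i))) = 0" ..
  qed
  then show thesis using Q by (intro that[of s1]) (auto simp: Q_def)
qed

text \<open>A symmetric highest weight function on the rows from \<open>j\<close> on lives on words with values up to \<open>j\<close>:
  by symmetry all terms of a raising sum are equal, so they cannot cancel.\<close>

lemma highest_weight_symmetric:
  assumes fin: "finite A" and hw: "highest_weight_at h A j s" and s: "h s \<noteq> 0"
    and sym: "\<And>x y s. x \<in> A \<Longrightarrow> y \<in> A \<Longrightarrow> h (s \<circ> Transposition.transpose x y) = h s"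
    and x: "x \<in> A"
  shows "s x \<le> j"
proof (rule ccontr)
  assume "\<not> s x \<le> j"
  then obtain i where i: "s x = Suc i" "j \<le> i" by (metis not_less_eq_eq Suc_le_D Suc_le_mono)
  define s' where "s' = s(x := i)"
  have "h (s'(y := Suc i)) = h s" if y: "y \<in> A" "s' y = i" for y
  proof -
    have "s'(y := Suc i) = s \<circ> Transposition.transpose x y"
      using i y by (auto simp: s'_def fun_eq_iff Transposition.transpose_def)
    then show ?thesis using sym x y by simp
  qed
  then have "(\<Sum>y | y \<in> A \<and> s' y = i. h (s'(y := Suc i))) = of_nat (card {y. y \<in> A \<and> s' y = i}) * h s"
    by simp
  moreover have "(\<Sum>y | y \<in> A \<and> s' y = i. h (s'(y := Suc i))) = 0"
  proof (rule hw[unfolded highest_weight_at_def, rule_format])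
    show "s' y = s y" if "y \<notin> A" for y using that x by (auto simp: s'_def)
  qed (rule i(2))
  moreover have "x \<in> {y. y \<in> A \<and> s' y = i}" using x by (simp add: s'_def)
  then have "card {y. y \<in> A \<and> s' y = i} \<noteq> 0" using fin by (auto simp: card_eq_0_iff)
  ultimately show False using s by simp
qed

text \<open>Peels off the rows \<open>R 0, R 1, \<dots>\<close> one after the other.  Once the entries of \<open>R r\<close> lie in rows
  up to \<open>r\<close>, they do not take part in the raising operators from row \<open>Suc r\<close> on, so the
  remaining entries satisfy the highest weight condition for those.\<close>

lemma highest_weight_rows:
  assumes fin: "\<And>r. finite (\<Union>r'\<in>{r..}. R r')"
    and disj: "\<And>r r'. r \<noteq> r' \<Longrightarrow> R r \<inter> R r' = {}"
    and hw: "highest_weight_at h (\<Union>r. R r) 0 s0" and s0: "h s0 \<noteq> 0"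
    and sym: "\<And>r x y s. x \<in> R r \<Longrightarrow> y \<in> R r \<Longrightarrow> h (s \<circ> Transposition.transpose x y) = h s"
    and bound: "\<And>s x. h s \<noteq> 0 \<Longrightarrow> x \<in> (\<Union>r. R r) \<Longrightarrow> s x \<le> N"
  shows "\<exists>s. h s \<noteq> 0 \<and> (\<forall>r<m. \<forall>x\<in>R r. s x \<le> r) \<and> highest_weight_at h (\<Union>r\<in>{m..}. R r) m s"
proof (induction m)
  case 0
  have "{0::nat..} = UNIV" by auto
  then show ?case using hw s0 by auto
next
  case (Suc m)
  then obtain s where s: "h s \<noteq> 0" "\<forall>r<m. \<forall>x\<in>R r. s x \<le> r"
    and hw_s: "highest_weight_at h (\<Union>r\<in>{m..}. R r) m s" by blast
  define A where "A = (\<Union>r\<in>{Suc m..}. R r)"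
  have "{m..} = insert m {Suc m..}" by auto
  then have split: "(\<Union>r\<in>{m..}. R r) = R m \<union> A" by (simp add: A_def)
  have finA: "finite (R m)" "finite A" using fin[of m] by (auto simp: split)
  have RA: "R m \<inter> A = {}" using disj by (auto simp: A_def) (metis disjoint_iff Suc_n_not_le_n)
  have bound_A: "s x \<le> N" if "h s \<noteq> 0" "x \<in> A" for s x
    using that by (intro bound) (auto simp: A_def)
  obtain s1 where s1: "h s1 \<noteq> 0" "\<And>x. x \<notin> R m \<union> A \<Longrightarrow> s1 x = s x" "highest_weight_at h (R m) m s1"
    by (rule highest_weight_restrict[where N = N, OF finA RA hw_s[unfolded split] s(1)])
      (use bound_A in blast)+
  have le_m: "s1 x \<le> m" if "x \<in> R m" for x
    by (rule highest_weight_symmetric[OF finA(1) s1(3,1) _ that]) (rule sym)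
  have "s1 x \<le> r" if r: "r < Suc m" "x \<in> R r" for r x
  proof (cases "r = m")
    case False
    then have "\<forall>r'\<ge>m. x \<notin> R r'" using r disj[of r] by (metis disjoint_iff leD less_SucE)
    then have "x \<notin> R m \<union> A" by (auto simp flip: split)
    then show ?thesis using s1(2) s(2) r False by auto
  qed (use r le_m in auto)
  moreover have "highest_weight_at h A (Suc m) s1"
    unfolding highest_weight_at_def
  proof (intro allI impI)
    fix s' i assume s': "\<forall>x. x \<notin> A \<longrightarrow> s' x = s1 x" and i: "Suc m \<le> i"
    have "s' y \<noteq> i" if "y \<in> R m" for y
      using s' that RA le_m[OF that] i by (metis disjoint_iff Suc_n_not_le_n le_trans)
    then have "{y. y \<in> A \<and> s' y = i} = {y. y \<in> R m \<union> A \<and> s' y = i}" by auto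
    moreover have "\<forall>x. x \<notin> R m \<union> A \<longrightarrow> s' x = s x" using s' s1(2) by auto
    ultimately show "(\<Sum>y | y \<in> A \<and> s' y = i. h (s'(y := Suc i))) = 0"
      using hw_s[unfolded split highest_weight_at_def, rule_format, of s' i] i by simp
  qed
  ultimately show ?case using s1(1) unfolding A_def by blast
qed

subsection \<open>Vanishing when the diagram does not fit\<close>

lemma transpose_absorb_row_coset:
  assumes t': "bij_betw t' (diagram lam) X"
    and xy: "x \<in> tabloid lam t' r" "y \<in> tabloid lam t' r" and p: "p \<in> row_coset lam X t t'"
  shows "Transposition.transpose x y \<circ> p \<in> row_coset lam X t t'"
proof -
  have inj: "inj_on t' (diagram lam)" and im: "t' ` diagram lam = X"
    using t' by (auto simp: bij_betw_def)
  have X: "tabloid lam t' i \<subseteq> X" for i using im by (auto simp: tabloid_def)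
  have "Transposition.transpose x y ` tabloid lam t' i = tabloid lam t' i" for i
  proof (cases "i = r")
    case True
    then show ?thesis using xy by (simp add: transpose_image_eq)
  next
    case False
    have "x \<notin> tabloid lam t' i" "y \<notin> tabloid lam t' i"
      using xy False by (auto simp: tabloid_def inj_on_eq_iff[OF inj])
    then show ?thesis by (simp add: transpose_image_eq)
  qed
  moreover have "p permutes X" "tabloid lam (p \<circ> t) = tabloid lam t'"
    using p by (auto simp: row_coset_def)
  moreover have "Transposition.transpose x y permutes X"
    using xy X by (intro permutes_swap_id) blast+
  ultimately show ?thesis
    unfolding row_coset_def mem_Collect_eq comp_assoc
    by (simp only: permutes_compose tabloid_comp[of lam _ "p \<circ> t"] simp_thms)
qed

lemma finite_row_coset: "finite X \<Longrightarrow> finite (row_coset lam X t t')"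
  unfolding row_coset_def by (rule finite_subset[OF _ finite_permutations[of X]]) auto

text \<open>If the Young symmetrizer does not annihilate \<open>v\<close>, the highest weight argument produces a word on
  which \<open>column_antisym lam X t v\<close> does not vanish and whose values on row \<open>r\<close> of \<open>t\<close> are at most \<open>r\<close>.
  Antisymmetry makes the word injective on every column, so that its value on row \<open>r\<close> is exactly \<open>r\<close>.
  Row \<open>r\<close> of \<open>lam\<close> is thus part of row \<open>r\<close> of a tabloid of shape \<open>nu\<close>.\<close>

lemma row_sum_column_antisym_eq_0:
  assumes nu: "is_partition nu" and lam: "is_partition lam" and nle: "\<not> (\<forall>i. lam i \<le> nu i)"
    and X: "X \<subseteq> {1..psize nu}"
    and t: "bij_betw t (diagram lam) X" and t': "bij_betw t' (diagram lam) X"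
    and v: "v \<in> specht nu"
  shows "row_sum lam X t t' (column_antisym lam X t v) = 0"
proof (rule ccontr)
  define n where "n = psize nu"
  define w where "w = column_antisym lam X t v"
  define u where "u = row_sum lam X t t' w"
  define h where "h s = u (row_sets n s)" for s
  assume "row_sum lam X t t' (column_antisym lam X t v) \<noteq> 0"
  then have "u \<noteq> 0" by (simp add: u_def w_def)
  have finX: "finite X" using X finite_subset by blast
  have w: "w \<in> specht nu" unfolding w_def using X v by (rule column_antisym_specht)
  have u: "u \<in> specht nu" unfolding u_def using X w by (rule row_sum_specht)
  have Xn: "X \<subseteq> {1..n}" using X by (simp add: n_def)
  have perm_n: "p permutes {1..n}" if "p permutes X" for p using that Xn by (rule permutes_subset)
  have h_eq: "h s = (\<Sum>p\<in>row_coset lam X t t'. w (row_sets n (s \<circ> p)))" for s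
    unfolding h_def u_def row_sum_def sum_fun_apply
    by (intro sum.cong refl perm_act_row_sets perm_n) (simp add: row_coset_def)
  have row_sets_nonzero: "\<exists>t. tableau nu t \<and> row_sets n s = tabloid nu t"
    if "f \<in> specht nu" "f (row_sets n s) \<noteq> 0" for f s
    using specht_support[OF that] .

  obtain N where N: "\<And>i. nu i \<noteq> 0 \<Longrightarrow> i \<le> N"
    using nu by (auto simp: is_partition_def finite_nat_set_iff_bounded_le)
  have bound: "s x \<le> N" if hs: "h s \<noteq> 0" and x: "x \<in> {1..n}" for s x
  proof -
    obtain t0 where "row_sets n s = tabloid nu t0"
      using row_sets_nonzero[OF u] hs by (auto simp: h_def)
    moreover have "x \<in> row_sets n s (s x)" using x by (simp add: row_sets_def)
    ultimately have "x \<in> tabloid nu t0 (s x)" by simp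
    then have "nu (s x) \<noteq> 0" by (auto simp: tabloid_def diagram_def)
    then show ?thesis by (rule N)
  qed

  obtain T where T: "u T \<noteq> 0" using \<open>u \<noteq> 0\<close> by (auto simp: fun_eq_iff)
  obtain t0 where "tableau nu t0" "T = tabloid nu t0" using specht_support[OF u T] by blast
  then obtain s0 where s0: "h s0 \<noteq> 0" using T tabloid_eq_row_sets by (auto simp: h_def n_def)

  (* Passing to the leading term in the entries outside X, and then dealing with the rows of t'. *)
  have hw0: "highest_weight_at h (X \<union> ({1..n} - X)) 0 s0"
    using specht_raising_eq_0[OF _ u] nu Xn
    by (simp add: highest_weight_at_def h_def n_def is_partition_def Un_absorb1)
  obtain s1 where s1: "h s1 \<noteq> 0" "highest_weight_at h X 0 s1"
    by (rule highest_weight_restrict[where N = N, OF finX _ _ hw0 s0]) (use bound in blast)+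

  have UN: "(\<Union>r. tabloid lam t' r) = X"
  proof -
    have "(\<Union>r. tabloid lam t' r) = t' ` diagram lam" by (force simp: tabloid_def)
    then show ?thesis using bij_betw_imp_surj_on[OF t'] by simp
  qed
  have sym: "h (s \<circ> Transposition.transpose x y) = h s"
    if xy: "x \<in> tabloid lam t' r" "y \<in> tabloid lam t' r" for x y s r
    unfolding h_eq comp_assoc
    by (rule sum.reindex_bij_witness[where i = "\<lambda>p. Transposition.transpose x y \<circ> p"
          and j = "\<lambda>p. Transposition.transpose x y \<circ> p"])
      (simp_all add: transpose_absorb_row_coset[OF t' xy] flip: comp_assoc)
  obtain s where s: "h s \<noteq> 0" and s_le: "\<And>r x. x \<in> tabloid lam t' r \<Longrightarrow> s x \<le> r"
  proof -
    obtain m where m: "\<And>i. lam i \<noteq> 0 \<Longrightarrow> i < m"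
      using lam by (auto simp: is_partition_def finite_nat_set_iff_bounded)
    have "\<exists>s. h s \<noteq> 0 \<and> (\<forall>r<m. \<forall>x\<in>tabloid lam t' r. s x \<le> r) \<and>
        highest_weight_at h (\<Union>r\<in>{m..}. tabloid lam t' r) m s"
    proof (rule highest_weight_rows[where N = N])
      show "finite (\<Union>r'\<in>{r..}. tabloid lam t' r')" for r
        by (rule finite_subset[OF _ finX]) (use UN in blast)
      show "tabloid lam t' r \<inter> tabloid lam t' r' = {}" if "r \<noteq> r'" for r r'
        using that by (auto simp: tabloid_def inj_on_eq_iff[OF bij_betw_imp_inj_on[OF t']])
      show "highest_weight_at h (\<Union>r. tabloid lam t' r) 0 s1" unfolding UN by (rule s1(2))
      show "s x \<le> N" if "h s \<noteq> 0" "x \<in> (\<Union>r. tabloid lam t' r)" for s x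
        using that Xn unfolding UN by (blast intro: bound)
    qed (fact s1(1) sym)+
    then obtain s where s: "h s \<noteq> 0" "\<And>r x. r < m \<Longrightarrow> x \<in> tabloid lam t' r \<Longrightarrow> s x \<le> r" by blast
    have "s x \<le> r" if x: "x \<in> tabloid lam t' r" for x r
    proof -
      have "lam r \<noteq> 0" using x by (auto simp: tabloid_def diagram_def)
      then show ?thesis using s(2) x m by blast
    qed
    with s(1) show thesis by (rule that)
  qed

  (* Some summand of the row sum survives at s; p carries row r of t to row r of t'. *)
  obtain p where p: "p permutes X" "tabloid lam (p \<circ> t) = tabloid lam t'"
    and wp: "w (row_sets n (s \<circ> p)) \<noteq> 0"
  proof -
    have "(\<Sum>p\<in>row_coset lam X t t'. w (row_sets n (s \<circ> p))) \<noteq> 0" using s unfolding h_eq .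
    then obtain p where "p \<in> row_coset lam X t t'" "w (row_sets n (s \<circ> p)) \<noteq> 0"
      by (rule sum.not_neutral_contains_not_neutral)
    then show thesis using that[of p] by (simp add: row_coset_def)
  qed
  define s' where "s' = s \<circ> p"
  have s'_le: "s' (t (r, c)) \<le> r" if "(r, c) \<in> diagram lam" for r c
  proof -
    have "p (t (r, c)) \<in> tabloid lam (p \<circ> t) r" using that by (auto simp: tabloid_def)
    then show ?thesis using p(2) s_le by (simp add: s'_def)
  qed
  have s'_inj: "r = r'"
    if rc: "(r, c) \<in> diagram lam" "(r', c) \<in> diagram lam" and eq: "s' (t (r, c)) = s' (t (r', c))"
    for r r' c
  proof (rule ccontr)
    assume "r \<noteq> r'"
    define q where "q = Transposition.transpose (t (r, c)) (t (r', c))"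
    have q: "q \<in> column_group lam X t" unfolding q_def using t rc by (rule transpose_in_column_group)
    have "t (r, c) \<noteq> t (r', c)" using \<open>r \<noteq> r'\<close> inj_on_eq_iff[OF bij_betw_imp_inj_on[OF t] rc] by simp
    then have "perm_act q w = - 1 *\<^sub>C w"
      using perm_act_column_antisym[OF q finX, of v] by (simp add: w_def q_def sign_swap_id)
    moreover have "perm_act q w (row_sets n s') = w (row_sets n (s' \<circ> q))"
      using perm_n[OF column_group_permutes[OF q]] by (rule perm_act_row_sets)
    moreover have "s' \<circ> q = s'" using eq by (auto simp: q_def fun_eq_iff Transposition.transpose_def)
    ultimately show False using wp by (simp add: s'_def cscale_def)
  qed
  (* The r cells above the cell (r, c) already use up the values below r. *)
  have s'_eq: "s' (t (r, c)) = r" if "(r, c) \<in> diagram lam" for r c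
    using that
  proof (induction r rule: less_induct)
    case (less r)
    have "s' (t (r, c)) \<noteq> r'" if "r' < r" for r'
    proof -
      have "(r', c) \<in> diagram lam"
        using less.prems lam that by (auto simp: diagram_def is_partition_def dest!: antimonoD[of lam r' r])
      then show ?thesis using less.IH[OF that] s'_inj[OF less.prems, of r'] that by auto
    qed
    then show ?case using s'_le[OF less.prems] by (metis le_neq_implies_less)
  qed

  obtain t1 where t1: "tableau nu t1" "row_sets n s' = tabloid nu t1"
    using row_sets_nonzero[OF w] wp by (auto simp: s'_def)
  have "lam r \<le> nu r" for r
  proof -
    have "inj_on (\<lambda>c. t (r, c)) {..<lam r}"
      using t by (auto simp: bij_betw_def inj_on_def diagram_def)
    then have "lam r = card ((\<lambda>c. t (r, c)) ` {..<lam r})" by (simp add: card_image)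
    also have "\<dots> \<le> card ((\<lambda>c. t1 (r, c)) ` {..<nu r})"
    proof (rule card_mono)
      have "t (r, c) \<in> row_sets n s' r" if "c < lam r" for c
      proof -
        have d: "(r, c) \<in> diagram lam" using that by (simp add: diagram_def)
        then have "t (r, c) \<in> {1..n}" using bij_betwE[OF t] Xn by blast
        then show ?thesis using s'_eq[OF d] by (simp add: row_sets_def)
      qed
      then show "(\<lambda>c. t (r, c)) ` {..<lam r} \<subseteq> (\<lambda>c. t1 (r, c)) ` {..<nu r}"
        unfolding t1(2) by (force simp: tabloid_def diagram_def)
    qed simp
    also have "\<dots> \<le> nu r" using card_image_le[of "{..<nu r}"] by simp
    finally show ?thesis .
  qed
  with nle show False by blast
qed

subsection \<open>Non-vanishing when the diagram fits\<close>

lemma conjugate_permutes: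
  assumes "q permutes X" "bij p"
  shows "p \<circ> q \<circ> inv p permutes p ` X"
proof (rule bij_imp_permutes)
  have "bij_betw (inv p) (p ` X) X"
    using assms(2) by (simp add: bij_betw_def bij_is_inj image_inv_f_f inj_on_inv_into)
  moreover have "bij_betw p X (p ` X)" using assms(2) by (meson bij_betw_subset subset_UNIV)
  ultimately show "bij_betw (p \<circ> q \<circ> inv p) (p ` X) (p ` X)"
    using bij_betw_trans permutes_imp_bij[OF assms(1)] by metis
  show "(p \<circ> q \<circ> inv p) x = x" if "x \<notin> p ` X" for x
  proof -
    have "p (inv p x) = x" using assms(2) by (simp add: bij_is_surj surj_f_inv_f)
    moreover from this have "inv p x \<notin> X" using that by (metis imageI)
    ultimately show ?thesis using permutes_not_in[OF assms(1)] by simp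
  qed
qed

lemma conjugate_column_group:
  assumes q: "q \<in> column_group lam X t" and p: "bij p"
  shows "p \<circ> q \<circ> inv p \<in> column_group lam (p ` X) (p \<circ> t)"
proof -
  have "(p \<circ> q \<circ> inv p) ` p ` A = p ` q ` A" for A
    using p by (simp add: image_image bij_is_inj)
  then show ?thesis
    using q conjugate_permutes[OF column_group_permutes[OF q] p]
    by (simp add: column_group_def tableau_column_comp)
qed

lemma conjugate_row_coset:
  assumes q: "q \<in> row_coset lam X t t'" and p: "bij p"
  shows "p \<circ> q \<circ> inv p \<in> row_coset lam (p ` X) (p \<circ> t) (p \<circ> t')"
proof -
  have "(p \<circ> q \<circ> inv p) \<circ> (p \<circ> t) = p \<circ> (q \<circ> t)"
    using p by (simp add: fun_eq_iff bij_is_inj)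
  then show ?thesis
    using q conjugate_permutes[of q X p] p
    by (simp only: row_coset_def mem_Collect_eq tabloid_comp[of _ p] simp_thms)
qed

lemma conjugate_inverse:
  assumes "bij p"
  shows "inv p \<circ> (p \<circ> q \<circ> inv p) \<circ> p = q" "p \<circ> (inv p \<circ> q \<circ> p) \<circ> inv p = q"
  using assms by (simp_all add: fun_eq_iff bij_is_inj bij_is_surj surj_f_inv_f)

lemma sum_conjugate:
  fixes p :: "'a \<Rightarrow> 'a"
  assumes p: "bij p"
    and conj: "\<And>q. q \<in> A \<Longrightarrow> p \<circ> q \<circ> inv p \<in> B" "\<And>q. q \<in> B \<Longrightarrow> inv p \<circ> q \<circ> p \<in> A"
  shows "sum g B = (\<Sum>q\<in>A. g (p \<circ> q \<circ> inv p))"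
  by (rule sum.reindex_bij_witness[where i = "\<lambda>q. p \<circ> q \<circ> inv p" and j = "\<lambda>q. inv p \<circ> q \<circ> p"])
    (simp_all only: conjugate_inverse[OF p] conj)

lemma perm_act_conjugate:
  assumes "bij p" "bij q"
  shows "perm_act (p \<circ> q \<circ> inv p) (perm_act p v) = perm_act p (perm_act q v)"
proof -
  have "p \<circ> q \<circ> inv p \<circ> p = p \<circ> q" using assms(1) by (simp add: fun_eq_iff bij_is_inj)
  then show ?thesis
    using assms by (simp add: perm_act_compose bij_comp bij_imp_bij_inv)
qed

lemma column_antisym_conjugate:
  assumes p: "p permutes S" "finite S" and X: "finite X"
  shows "column_antisym lam (p ` X) (p \<circ> t) (perm_act p v) = perm_act p (column_antisym lam X t v)"
proof -
  have bij: "bij p" and perm: "permutation p" "permutation (inv p)"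
    using p permutes_bij[OF p(1)] permutes_inv[OF p(1)] by (auto simp: permutation_permutes)
  have bwd: "inv p \<circ> q \<circ> p \<in> column_group lam X t" if "q \<in> column_group lam (p ` X) (p \<circ> t)" for q
  proof -
    have "inv p \<circ> (p \<circ> t) = t" using bij by (simp add: fun_eq_iff bij_is_inj)
    then show ?thesis
      using conjugate_column_group[OF that bij_imp_bij_inv[OF bij]] bij
      by (simp add: inv_inv_eq image_inv_f_f bij_is_inj)
  qed
  have "column_antisym lam (p ` X) (p \<circ> t) (perm_act p v) =
      (\<Sum>q\<in>column_group lam X t. of_int (sign (p \<circ> q \<circ> inv p)) *\<^sub>C
        perm_act (p \<circ> q \<circ> inv p) (perm_act p v))"
    unfolding column_antisym_def using bij conjugate_column_group bwd by (intro sum_conjugate) auto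
  also have "\<dots> = (\<Sum>q\<in>column_group lam X t. of_int (sign q) *\<^sub>C perm_act p (perm_act q v))"
  proof (intro sum.cong refl)
    fix q assume "q \<in> column_group lam X t"
    then have "q permutes X" by (rule column_group_permutes)
    then have q: "permutation q" "bij q" using X permutes_bij by (auto simp: permutation_permutes)
    have "sign (p \<circ> q \<circ> inv p) = sign q"
      using q perm by (simp add: sign_compose sign_inverse permutation_compose sign_idempotent)
    then show "of_int (sign (p \<circ> q \<circ> inv p)) *\<^sub>C perm_act (p \<circ> q \<circ> inv p) (perm_act p v) =
        of_int (sign q) *\<^sub>C perm_act p (perm_act q v)"
      by (simp add: perm_act_conjugate bij q)
  qed
  finally show ?thesis by (simp add: column_antisym_def perm_act_sum perm_act_scale)
qed

lemma row_sum_conjugate: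
  assumes bij: "bij p"
  shows "row_sum lam (p ` X) (p \<circ> t) (p \<circ> t') (perm_act p v) = perm_act p (row_sum lam X t t' v)"
proof -
  have bwd: "inv p \<circ> q \<circ> p \<in> row_coset lam X t t'"
    if "q \<in> row_coset lam (p ` X) (p \<circ> t) (p \<circ> t')" for q
  proof -
    have "inv p \<circ> (p \<circ> s) = s" for s :: "nat \<times> nat \<Rightarrow> nat"
      using bij by (simp add: fun_eq_iff bij_is_inj)
    then show ?thesis
      using conjugate_row_coset[OF that bij_imp_bij_inv[OF bij]] bij
      by (simp add: inv_inv_eq image_inv_f_f bij_is_inj)
  qed
  have "row_sum lam (p ` X) (p \<circ> t) (p \<circ> t') (perm_act p v) =
      (\<Sum>q\<in>row_coset lam X t t'. perm_act (p \<circ> q \<circ> inv p) (perm_act p v))"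
    unfolding row_sum_def using bij conjugate_row_coset bwd by (intro sum_conjugate) auto
  also have "\<dots> = (\<Sum>q\<in>row_coset lam X t t'. perm_act p (perm_act q v))"
    using bij by (intro sum.cong refl perm_act_conjugate) (auto simp: row_coset_def permutes_bij)
  finally show ?thesis by (simp add: row_sum_def perm_act_sum)
qed

definition tabloids :: "(nat \<Rightarrow> nat) \<Rightarrow> (nat \<Rightarrow> nat set) set"
  where "tabloids lam = {tabloid lam t | t. tableau lam t}"

definition tabloid_ip ::
    "(nat \<Rightarrow> nat) \<Rightarrow> ((nat \<Rightarrow> nat set) \<Rightarrow> complex) \<Rightarrow> ((nat \<Rightarrow> nat set) \<Rightarrow> complex) \<Rightarrow> complex"
  where "tabloid_ip lam u v = (\<Sum>T\<in>tabloids lam. u T * cnj (v T))"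

lemma finite_tabloids:
  assumes "is_partition lam"
  shows "finite (tabloids lam)"
proof (rule finite_subset)
  let ?A = "{i. lam i \<noteq> 0}" and ?B = "Pow {1..psize lam}"
  show "tabloids lam \<subseteq> {T. \<forall>i. (i \<in> ?A \<longrightarrow> T i \<in> ?B) \<and> (i \<notin> ?A \<longrightarrow> T i = {})}"
  proof
    fix T assume "T \<in> tabloids lam"
    then obtain t where t: "t ` diagram lam = {1..psize lam}" "T = tabloid lam t"
      by (auto simp: tabloids_def tableau_def bij_betw_def)
    have "T i \<subseteq> t ` diagram lam" for i using t(2) by (auto simp: tabloid_def)
    moreover have "T i = {}" if "lam i = 0" for i using t(2) that by (auto simp: tabloid_def diagram_def)
    ultimately show "T \<in> {T. \<forall>i. (i \<in> ?A \<longrightarrow> T i \<in> ?B) \<and> (i \<notin> ?A \<longrightarrow> T i = {})}"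
      unfolding t(1) by auto
  qed
  show "finite {T. \<forall>i. (i \<in> ?A \<longrightarrow> T i \<in> ?B) \<and> (i \<notin> ?A \<longrightarrow> T i = {})}"
    using assms by (intro finite_set_of_finite_funs) (auto simp: is_partition_def)
qed

lemma specht_subset_span_point:
  assumes "is_partition lam"
  shows "specht lam \<subseteq> cfun.span (point ` tabloids lam)"
proof
  fix v assume v: "v \<in> specht lam"
  have "v T = (\<Sum>U\<in>tabloids lam. v U *\<^sub>C point U) T" for T
    using specht_support[OF v, of T] finite_tabloids[OF assms]
    by (cases "v T = 0") (auto simp: sum_fun_apply cscale_def point_def tabloids_def if_distrib cong: if_cong)
  then have "v = (\<Sum>U\<in>tabloids lam. v U *\<^sub>C point U)" by blast
  also have "\<dots> \<in> cfun.span (point ` tabloids lam)"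
    by (intro cfun.span_sum cfun.span_scale cfun.span_base) blast
  finally show "v \<in> cfun.span (point ` tabloids lam)" .
qed

lemma inner_product_tabloid_ip:
  assumes lam: "is_partition lam"
  shows "inner_product_on (specht lam) (tabloid_ip lam)"
proof -
  have pos: "0 < Re (tabloid_ip lam v v)" if v: "v \<in> specht lam" "v \<noteq> 0" for v
  proof -
    obtain T where T: "v T \<noteq> 0" using v(2) by (auto simp: fun_eq_iff)
    then have "T \<in> tabloids lam" using specht_support[OF v(1) T] unfolding tabloids_def by blast
    then have "0 < (\<Sum>T\<in>tabloids lam. (cmod (v T))\<^sup>2)"
      using T finite_tabloids[OF lam] by (intro sum_pos2[of _ T]) auto
    also have "\<dots> = Re (tabloid_ip lam v v)"
      by (simp add: tabloid_ip_def complex_mult_cnj cmod_power2)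
    finally show ?thesis .
  qed
  show ?thesis
    unfolding inner_product_on_def
    by (intro conjI ballI allI impI pos)
      (simp_all add: tabloid_ip_def cscale_def algebra_simps sum.distrib sum_distrib_left)
qed

text \<open>The column antisymmetrizer is self-adjoint, and it maps the tabloid of \<open>t\<close> to the polytabloid.\<close>

lemma tabloid_ip_polytabloid:
  assumes lam: "is_partition lam" and t: "tableau lam t"
  shows "tabloid_ip lam w (polytabloid lam t) = column_antisym lam {1..psize lam} t w (tabloid lam t)"
proof -
  define C where "C = column_group lam {1..psize lam} t"
  have inv: "inv p \<in> C" "inv (inv p) = p" "permutation p" if "p \<in> C" for p
    using that inv_in_column_group[of p lam _ t] permutes_inv_inv[of p] column_group_permutes[of p lam _ t]
    unfolding C_def by (auto simp: permutation_permutes)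
  have "tabloid_ip lam w (polytabloid lam t) = (\<Sum>T\<in>tabloids lam. \<Sum>p\<in>C.
      if T = tabloid lam (p \<circ> t) then of_int (sign p) * w T else 0)"
    unfolding tabloid_ip_def polytabloid_apply column_stabilizer_eq C_def[symmetric] cnj_sum sum_distrib_left
    by (intro sum.cong refl) simp
  also have "\<dots> = (\<Sum>p\<in>C. \<Sum>T\<in>tabloids lam.
      if T = tabloid lam (p \<circ> t) then of_int (sign p) * w T else 0)"
    by (rule sum.swap)
  also have "\<dots> = (\<Sum>p\<in>C. of_int (sign p) * w (tabloid lam (p \<circ> t)))"
  proof (intro sum.cong refl)
    fix p assume "p \<in> C"
    then have "tabloid lam (p \<circ> t) \<in> tabloids lam"
      using tableau_perm[OF t column_group_permutes] unfolding C_def tabloids_def by blast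
    then show "(\<Sum>T\<in>tabloids lam. if T = tabloid lam (p \<circ> t) then of_int (sign p) * w T else 0) =
        of_int (sign p) * w (tabloid lam (p \<circ> t))"
      using finite_tabloids[OF lam] by simp
  qed
  also have "\<dots> = (\<Sum>p\<in>C. of_int (sign p) * w (tabloid lam (inv p \<circ> t)))"
    by (rule sum.reindex_bij_witness[where i = inv and j = inv]) (auto simp: inv sign_inverse)
  also have "\<dots> = column_antisym lam {1..psize lam} t w (tabloid lam t)"
    unfolding column_antisym_def C_def[symmetric] sum_fun_apply by (simp add: cscale_def perm_act_def tabloid_comp)
  finally show ?thesis .
qed

text \<open>Otherwise \<open>w\<close> would be orthogonal to all polytabloids, hence to itself.\<close>

lemma exists_nonzero_on_tabloid:
  assumes nu: "is_partition nu" and w: "w \<in> specht nu" "w \<noteq> 0"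
  shows "\<exists>t. tableau nu t \<and> column_antisym nu {1..psize nu} t w (tabloid nu t) \<noteq> 0"
proof (rule ccontr)
  interpret inner_product_subspace "specht nu" "tabloid_ip nu"
    by unfold_locales (simp_all add: subspace_specht inner_product_tabloid_ip nu)
  assume no: "\<not> ?thesis"
  have "v \<in> specht nu \<and> tabloid_ip nu w v = 0" if "v \<in> specht nu" for v
    using that
  proof (induction rule: specht_induct)
    case (polytabloid t)
    then show ?case using no tabloid_ip_polytabloid[OF nu] by (auto simp: polytabloid_in_specht)
  next
    case (add u v)
    then have "tabloid_ip nu w (u + v) = 0"
      by (simp add: tabloid_ip_def distrib_left sum.distrib)
    with add show ?case using cfun.subspace_add[OF subspace] by blast
  next
    case (scale c v)
    then show ?case using w by (simp add: ip_scale_right scale_mem)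
  next
    case zero
    show ?case by (intro conjI cfun.subspace_0[OF subspace]) (simp add: tabloid_ip_def)
  qed
  then show False using ip_self_eq_0_iff[OF w(1)] w by simp
qed

text \<open>Let \<open>u\<close> be the column antisymmetrization of \<open>w\<close> along a tableau \<open>T\<close> of shape \<open>nu\<close>, chosen such
  that \<open>u\<close> does not vanish at the tabloid of \<open>T\<close>, and let \<open>t\<close> be the part of \<open>T\<close> inside the diagram
  of \<open>lam\<close>.  The column group of \<open>t\<close> is contained in that of \<open>T\<close>, so it acts on \<open>u\<close> by the sign, and
  the row group of \<open>t\<close> fixes the tabloid of \<open>T\<close>.  The Young symmetrizer of \<open>t\<close> therefore merely
  multiplies the value of \<open>u\<close> at this tabloid by a positive integer.  Since \<open>u\<close> is a combination of
  translates of \<open>w\<close>, a conjugate of this Young symmetrizer does not annihilate \<open>w\<close>.\<close>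

lemma exists_row_sum_column_antisym_nonzero:
  assumes nu: "is_partition nu" and w: "w \<in> specht nu" "w \<noteq> 0" and le: "\<forall>i. lam i \<le> nu i"
  shows "\<exists>X t. X \<subseteq> {1..psize nu} \<and> bij_betw t (diagram lam) X \<and>
    row_sum lam X t t (column_antisym lam X t w) \<noteq> 0"
proof -
  define n where "n = psize nu"
  obtain T where T: "tableau nu T" and nz: "column_antisym nu {1..n} T w (tabloid nu T) \<noteq> 0"
    using exists_nonzero_on_tabloid[OF nu w] by (auto simp: n_def)
  define u where "u = column_antisym nu {1..n} T w"
  have bijT: "bij_betw T (diagram nu) {1..n}" using T by (simp add: tableau_def n_def)
  note injT = bij_betw_imp_inj_on[OF bijT] and imT = bij_betw_imp_surj_on[OF bijT]
  have sub: "diagram lam \<subseteq> diagram nu" using le by (auto simp: diagram_def intro: less_le_trans)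
  define X where "X = T ` diagram lam"
  have X: "X \<subseteq> {1..n}" and finX: "finite X"
    using image_mono[OF sub, of T] finite_subset[of X "{1..n}"] unfolding X_def imT by auto
  have notin_X: "T d \<notin> X" if "d \<in> diagram nu" "d \<notin> diagram lam" for d
    using inj_on_image_mem_iff[OF injT that(1) sub] that(2) by (simp add: X_def)
  have bij: "bij_betw T (diagram lam) X"
    unfolding X_def using injT sub by (meson inj_on_imp_bij_betw inj_on_subset)
  (* A permutation of X that preserves a row or column of the restricted filling also preserves
     that of T, since it fixes the entries outside X.  Here B is the set of cells of the row or column. *)
  have extend: "p ` T ` B = T ` B"
    if p: "p permutes X" and B: "B \<subseteq> diagram nu" and pB: "p ` T ` (B \<inter> diagram lam) = T ` (B \<inter> diagram lam)"
    for p B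
  proof (rule endo_inj_surj)
    show "finite (T ` B)" 
      by (rule finite_subset[of _ "{1..n}"]) (use image_mono[OF B, of T] imT in simp_all)
    show "inj_on p (T ` B)" using permutes_inj[OF p] by (rule inj_on_subset) simp
    show "p ` T ` B \<subseteq> T ` B"
    proof clarify
      fix d assume d: "d \<in> B"
      show "p (T d) \<in> T ` B"
      proof (cases "d \<in> diagram lam")
        case True
        then have "p (T d) \<in> p ` T ` (B \<inter> diagram lam)" using d by blast
        then show ?thesis unfolding pB by blast
      next
        case False
        then have "T d \<notin> X" using notin_X B d by blast
        then show ?thesis using permutes_not_in[OF p] d by simp
      qed
    qed
  qed
  have col: "p \<in> column_group nu {1..n} T" if p: "p \<in> column_group lam X T" for p
  proof -
    have pX: "p permutes X" using p by (rule column_group_permutes)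
    have "p ` tableau_column nu T j = tableau_column nu T j" for j
    proof -
      let ?B = "{(i, j') \<in> diagram nu. j' = j}"
      have nuB: "tableau_column nu T j = T ` ?B" by (auto simp: tableau_column_def)
      have lamB: "tableau_column lam T j = T ` (?B \<inter> diagram lam)" using sub by (auto simp: tableau_column_def)
      have "p ` tableau_column lam T j = tableau_column lam T j"
        using p by (simp add: column_group_def)
      from extend[OF pX _ this[unfolded lamB]] show ?thesis unfolding nuB by blast
    qed
    then show ?thesis using permutes_subset[OF pX X] by (simp add: column_group_def)
  qed
  have row: "perm_act p u (tabloid nu T) = u (tabloid nu T)" if p: "p \<in> row_coset lam X T T" for p
  proof -
    have pX: "p permutes X" using p by (simp add: row_coset_def)
    have "p ` tabloid nu T i = tabloid nu T i" for i
    proof -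
      let ?B = "{(i', j) \<in> diagram nu. i' = i}"
      have nuB: "tabloid nu T i = T ` ?B" by (auto simp: tabloid_def)
      have lamB: "tabloid lam T i = T ` (?B \<inter> diagram lam)" using sub by (auto simp: tabloid_def)
      have "tabloid lam (p \<circ> T) i = tabloid lam T i" using p by (simp add: row_coset_def)
      then have "p ` tabloid lam T i = tabloid lam T i" by (simp add: tabloid_comp)
      from extend[OF pX _ this[unfolded lamB]] show ?thesis unfolding nuB by blast
    qed
    then have "inv p ` tabloid nu T i = tabloid nu T i" for i
      by (metis image_inv_f_f permutes_inj[OF pX])
    then show ?thesis by (simp add: perm_act_def)
  qed
  let ?C = "column_group lam X T" and ?R = "row_coset lam X T T"
  have "perm_act p u = of_int (sign p) *\<^sub>C u" if "p \<in> ?C" for p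
    unfolding u_def using col[OF that] by (intro perm_act_column_antisym) auto
  then have "column_antisym lam X T u = (\<Sum>p\<in>?C. u)"
    unfolding column_antisym_def
    by (intro sum.cong refl) (simp add: sign_idempotent flip: of_int_mult)
  then have anti: "column_antisym lam X T u = of_nat (card ?C) *\<^sub>C u"
    by (simp add: fun_eq_iff sum_fun_apply cscale_def)
  have "row_sum lam X T T (column_antisym lam X T u) (tabloid nu T) =
      of_nat (card ?R) * of_nat (card ?C) * u (tabloid nu T)"
    unfolding anti row_sum_scale by (simp add: row_sum_def sum_fun_apply cscale_def row)
  moreover have "id \<in> ?R" by (simp add: row_coset_def permutes_id)
  then have "card ?R \<noteq> 0" using finite_row_coset[OF finX] by (auto simp: card_eq_0_iff)
  moreover have "card ?C \<noteq> 0"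
    using id_in_column_group[of lam X T] finite_column_group[OF finX, of lam T]
    by (auto simp: card_eq_0_iff)
  ultimately have *: "row_sum lam X T T (column_antisym lam X T u) \<noteq> 0"
    using nz by (auto simp: u_def)

  let ?CT = "column_group nu {1..n} T"
  have "row_sum lam X T T (column_antisym lam X T u) =
      (\<Sum>p\<in>?CT. of_int (sign p) *\<^sub>C row_sum lam X T T (column_antisym lam X T (perm_act p w)))"
    unfolding u_def column_antisym_def[of nu] by (simp only: column_antisym_sum column_antisym_scale row_sum_sum row_sum_scale)
  (* Conjugation turns the translate of w by p back into w. *)
  with * obtain p where p: "p \<in> ?CT"
    and pw: "row_sum lam X T T (column_antisym lam X T (perm_act p w)) \<noteq> 0"
    by (metis (no_types, lifting) cfun.scale_zero_right sum.neutral)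
  have perm_p: "p permutes {1..n}" and bij_p: "bij p"
    using column_group_permutes[OF p] permutes_bij by auto
  define Y where "Y = inv p ` X"
  define s where "s = inv p \<circ> T"
  have "p ` Y = X" "p \<circ> s = T" and finY: "finite Y"
    using bij_p finX by (simp_all add: Y_def s_def image_f_inv_f bij_is_surj fun_eq_iff surj_f_inv_f)
  then have "row_sum lam X T T (column_antisym lam X T (perm_act p w)) =
      perm_act p (row_sum lam Y s s (column_antisym lam Y s w))"
    using column_antisym_conjugate[OF perm_p _ finY, of lam s w] row_sum_conjugate[OF bij_p, of lam Y s s]
    by simp
  with pw have "row_sum lam Y s s (column_antisym lam Y s w) \<noteq> 0" by (auto simp: perm_act_def)
  moreover have "Y \<subseteq> {1..n}"
    using X permutes_in_image[OF permutes_inv[OF perm_p]] by (auto simp: Y_def)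
  moreover have "bij_betw s (diagram lam) Y"
    unfolding s_def Y_def using bij bij_imp_bij_inv[OF bij_p]
    by (intro bij_betw_trans[OF bij]) (meson bij_betw_subset subset_UNIV)
  ultimately show ?thesis unfolding n_def by blast
qed

section \<open>Character elements as Gram operators\<close>

subsection \<open>Transport along bijections of the entries\<close>

lemma tabloid_cong: "(\<And>d. d \<in> diagram lam \<Longrightarrow> s d = t d) \<Longrightarrow> tabloid lam s = tabloid lam t"
  by (auto simp: tabloid_def fun_eq_iff) metis+

lemma tableau_column_cong:
  "(\<And>d. d \<in> diagram lam \<Longrightarrow> s d = t d) \<Longrightarrow> tableau_column lam s = tableau_column lam t"
  by (auto simp: tableau_column_def fun_eq_iff) metis+

lemma map_permutation_comp_on:
  assumes "inj_on f X" "t ` diagram lam \<subseteq> X" "d \<in> diagram lam"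
  shows "(map_permutation X f p \<circ> (f \<circ> t)) d = (f \<circ> (p \<circ> t)) d"
  using assms by (auto simp: map_permutation_apply)

lemma map_permutation_column_group:
  assumes f: "bij_betw f X Y" and t: "t ` diagram lam \<subseteq> X" and p: "p \<in> column_group lam X t"
  shows "map_permutation X f p \<in> column_group lam Y (f \<circ> t)"
proof -
  have inj: "inj_on f X" using f by (rule bij_betw_imp_inj_on)
  have "map_permutation X f p ` tableau_column lam (f \<circ> t) j = tableau_column lam (f \<circ> t) j" for j
  proof -
    have "map_permutation X f p ` tableau_column lam (f \<circ> t) j =
        tableau_column lam (map_permutation X f p \<circ> (f \<circ> t)) j"
      by (simp only: tableau_column_comp)
    also have "\<dots> = tableau_column lam (f \<circ> (p \<circ> t)) j"
      using map_permutation_comp_on[OF inj t] by (rule tableau_column_cong[THEN fun_cong])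
    also have "\<dots> = f ` p ` tableau_column lam t j" by (simp only: tableau_column_comp)
    also have "\<dots> = f ` tableau_column lam t j" using p by (simp add: column_group_def)
    finally show ?thesis by (simp only: tableau_column_comp)
  qed
  then show ?thesis
    using map_permutation_permutes[OF f column_group_permutes[OF p]] by (simp add: column_group_def)
qed

lemma sum_column_group_map:
  assumes f: "bij_betw f X Y" and t: "t ` diagram lam \<subseteq> X"
  shows "sum F (column_group lam Y (f \<circ> t)) =
    (\<Sum>p\<in>column_group lam X t. F (map_permutation X f p))"
proof (rule sum.reindex_bij_witness[where i = "map_permutation X f"
        and j = "map_permutation Y (inv_into X f)"])
  let ?g = "inv_into X f"
  have g: "bij_betw ?g Y X" and gf: "\<And>x. x \<in> X \<Longrightarrow> ?g (f x) = x" and fg: "\<And>y. y \<in> Y \<Longrightarrow> f (?g y) = y"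
    using f by (auto simp: bij_betw_inv_into bij_betw_inv_into_left bij_betw_inv_into_right)
  show "map_permutation X f p \<in> column_group lam Y (f \<circ> t)" if "p \<in> column_group lam X t" for p
    using f t that by (rule map_permutation_column_group)
  show "map_permutation Y ?g (map_permutation X f p) = p" if "p \<in> column_group lam X t" for p
    using f column_group_permutes[OF that] gf by (rule map_permutation_compose_inv)
  fix q assume q: "q \<in> column_group lam Y (f \<circ> t)"
  show *: "map_permutation X f (map_permutation Y ?g q) = q"
    using g column_group_permutes[OF q] fg by (rule map_permutation_compose_inv)
  have "(f \<circ> t) ` diagram lam \<subseteq> Y" using bij_betw_imp_surj_on[OF f] t by auto
  then have "map_permutation Y ?g q \<in> column_group lam X (?g \<circ> (f \<circ> t))"
    using g q by (intro map_permutation_column_group)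
  moreover have "(?g \<circ> (f \<circ> t)) d = t d" if "d \<in> diagram lam" for d using gf t that by auto
  then have "tableau_column lam (?g \<circ> (f \<circ> t)) = tableau_column lam t" by (rule tableau_column_cong)
  ultimately show "map_permutation Y ?g q \<in> column_group lam X t" by (simp only: column_group_def)
  show "F (map_permutation X f (map_permutation Y ?g q)) = F q" unfolding * ..
qed

lemma bij_betw_rank:
  fixes X :: "nat set"
  assumes "finite X"
  shows "bij_betw (\<lambda>x. card {y \<in> X. y \<le> x}) X {1..card X}" (is "bij_betw ?f _ _")
proof -
  have less: "?f x < ?f y" if "x \<in> X" "y \<in> X" "x < y" for x y
  proof (rule psubset_card_mono)
    have "y \<in> {z \<in> X. z \<le> y}" "y \<notin> {z \<in> X. z \<le> x}" using that by auto
    moreover have "{z \<in> X. z \<le> x} \<subseteq> {z \<in> X. z \<le> y}" using that by auto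
    ultimately show "{z \<in> X. z \<le> x} \<subset> {z \<in> X. z \<le> y}" by blast
  qed (simp add: assms)
  have inj: "inj_on ?f X"
  proof (rule inj_onI)
    fix x y assume "x \<in> X" "y \<in> X" "?f x = ?f y"
    then show "x = y" using less[of x y] less[of y x] by (cases x y rule: linorder_cases) auto
  qed
  have "?f x \<in> {1..card X}" if "x \<in> X" for x
  proof -
    have "{y \<in> X. y \<le> x} \<noteq> {}" using that by auto
    then have "0 < ?f x" using assms by (simp add: card_gt_0_iff)
    moreover have "?f x \<le> card X" using assms by (intro card_mono) auto
    ultimately show ?thesis by simp
  qed
  then have "?f ` X \<subseteq> {1..card X}" by blast
  then have "?f ` X = {1..card X}" using card_image[OF inj] by (intro card_subset_eq) auto
  with inj show ?thesis by (simp add: bij_betw_def)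
qed

text \<open>The vectors \<open>\<Sum> p. (p u)(T) p v\<close> are the components along the tabloids \<open>T\<close> of the projection of
  \<open>u \<otimes> v\<close> to the invariants of the permutations of \<open>X\<close>, up to a factor.\<close>

definition mixed_vector ::
    "nat set \<Rightarrow> (nat \<Rightarrow> nat) \<Rightarrow> ((nat \<Rightarrow> nat set) \<Rightarrow> complex) \<Rightarrow> (nat \<Rightarrow> nat set) \<Rightarrow>
     ((nat \<Rightarrow> nat set) \<Rightarrow> complex) \<Rightarrow> (nat \<Rightarrow> nat set) \<Rightarrow> complex"
  where "mixed_vector X f u T v =
    (\<Sum>p | p permutes X. perm_act (map_permutation X f p) u T *\<^sub>C perm_act p v)"

lemma mixed_vector_0: "mixed_vector X f 0 T v = 0"
  and mixed_vector_add: "mixed_vector X f (u + u') T v = mixed_vector X f u T v + mixed_vector X f u' T v"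
  and mixed_vector_scale: "mixed_vector X f (c *\<^sub>C u) T v = c *\<^sub>C mixed_vector X f u T v"
  by (auto simp: mixed_vector_def perm_act_def cscale_def fun_eq_iff sum_fun_apply algebra_simps
      sum.distrib sum_distrib_left)

text \<open>For the polytabloid \<open>u\<close> of \<open>f \<circ> t\<close>, the coefficient \<open>(p u)(T)\<close> is the sum of the signs of the
  column permutations \<open>q\<close> for which \<open>p \<circ> q\<close> lies in the row coset.  Substituting \<open>p \<circ> inv q\<close> for \<open>p\<close>
  separates the two sums and leaves a Young symmetrizer applied to \<open>v\<close>.\<close>

lemma mixed_vector_polytabloid:
  assumes X: "finite X" and f: "bij_betw f X {1..psize lam}"
    and t: "t ` diagram lam \<subseteq> X" and t': "t' ` diagram lam \<subseteq> X"
  shows "mixed_vector X f (polytabloid lam (f \<circ> t)) (tabloid lam (f \<circ> t')) v =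
    row_sum lam X t t' (column_antisym lam X t v)"
proof -
  let ?G = "{p. p permutes X}" and ?C = "column_group lam X t" and ?R = "row_coset lam X t t'"
  note inj = bij_betw_imp_inj_on[OF f]
  have tab_eq: "tabloid lam (f \<circ> s) = tabloid lam (f \<circ> t') \<longleftrightarrow> tabloid lam s = tabloid lam t'"
    if s: "s ` diagram lam \<subseteq> X" for s
  proof -
    have "tabloid lam s i \<subseteq> X" "tabloid lam t' i \<subseteq> X" for i
      using s t' by (auto simp: tabloid_def)
    then show ?thesis
      by (simp only: tabloid_comp fun_eq_iff inj_on_image_eq_iff[OF inj])
  qed
  have coeff: "perm_act (map_permutation X f p) (polytabloid lam (f \<circ> t)) (tabloid lam (f \<circ> t')) =
      (\<Sum>q\<in>?C. of_int (sign q) * (if p \<circ> q \<in> ?R then 1 else 0))" if p: "p permutes X" for p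
  proof -
    let ?p = "map_permutation X f p"
    have "perm_act ?p (polytabloid lam (f \<circ> t)) =
        (\<Sum>q\<in>column_group lam {1..psize lam} (f \<circ> t).
          of_int (sign q) *\<^sub>C point (tabloid lam (?p \<circ> (q \<circ> (f \<circ> t)))))"
      unfolding polytabloid_def column_stabilizer_eq perm_act_sum perm_act_scale
      by (simp only: perm_act_point[OF map_permutation_permutes[OF f p]] tabloid_comp[of lam ?p])
    also have "\<dots> = (\<Sum>q\<in>?C. of_int (sign (map_permutation X f q)) *\<^sub>C
        point (tabloid lam (?p \<circ> (map_permutation X f q \<circ> (f \<circ> t)))))"
      using f t by (rule sum_column_group_map)
    also have "\<dots> = (\<Sum>q\<in>?C. of_int (sign q) *\<^sub>C point (tabloid lam (f \<circ> (p \<circ> q \<circ> t))))"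
    proof (intro sum.cong refl)
      fix q assume "q \<in> ?C"
      then have q: "q permutes X" by (rule column_group_permutes)
      have "sign (map_permutation X f q) = sign q" using inj q X by (rule sign_map_permutation)
      moreover have "?p \<circ> (map_permutation X f q \<circ> (f \<circ> t)) = map_permutation X f (p \<circ> q) \<circ> (f \<circ> t)"
        unfolding map_permutation_compose'[OF inj q] by (rule comp_assoc[symmetric])
      moreover have "tabloid lam (map_permutation X f (p \<circ> q) \<circ> (f \<circ> t)) = tabloid lam (f \<circ> (p \<circ> q \<circ> t))"
        using map_permutation_comp_on[OF inj t] by (rule tabloid_cong)
      ultimately show "of_int (sign (map_permutation X f q)) *\<^sub>C
          point (tabloid lam (?p \<circ> (map_permutation X f q \<circ> (f \<circ> t)))) =
          of_int (sign q) *\<^sub>C point (tabloid lam (f \<circ> (p \<circ> q \<circ> t)))"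
        by (simp only:)
    qed
    finally have "perm_act ?p (polytabloid lam (f \<circ> t)) (tabloid lam (f \<circ> t')) =
        (\<Sum>q\<in>?C. of_int (sign q) * (if tabloid lam (f \<circ> t') = tabloid lam (f \<circ> (p \<circ> q \<circ> t)) then 1 else 0))"
      by (simp only: sum_fun_apply cscale_def point_def)
    also have "\<dots> = (\<Sum>q\<in>?C. of_int (sign q) * (if p \<circ> q \<in> ?R then 1 else 0))"
    proof (intro sum.cong refl)
      fix q assume "q \<in> ?C"
      then have pq: "p \<circ> q permutes X" using p column_group_permutes permutes_compose by blast
      then have "(p \<circ> q \<circ> t) ` diagram lam \<subseteq> X"
        using t permutes_in_image[OF pq] by auto
      then have "tabloid lam (f \<circ> (p \<circ> q \<circ> t)) = tabloid lam (f \<circ> t') \<longleftrightarrow>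
          tabloid lam (p \<circ> q \<circ> t) = tabloid lam t'"
        by (rule tab_eq)
      moreover have "p \<circ> q \<in> ?R \<longleftrightarrow> tabloid lam (p \<circ> q \<circ> t) = tabloid lam t'"
        using pq by (simp only: row_coset_def mem_Collect_eq simp_thms)
      ultimately have "tabloid lam (f \<circ> t') = tabloid lam (f \<circ> (p \<circ> q \<circ> t)) \<longleftrightarrow> p \<circ> q \<in> ?R"
        by (simp only: eq_commute[of "tabloid lam (f \<circ> t')" "tabloid lam (f \<circ> (p \<circ> q \<circ> t))"])
      then show "of_int (sign q) * (if tabloid lam (f \<circ> t') = tabloid lam (f \<circ> (p \<circ> q \<circ> t)) then 1 else 0) =
          (of_int (sign q) * (if p \<circ> q \<in> ?R then 1 else 0) :: complex)" by (simp only:)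
    qed
    finally show ?thesis .
  qed
  have inv: "inv q \<in> ?C" "inv (inv q) = q" "permutation q" "bij q" "q \<circ> inv q = id" "inv q \<circ> q = id"
    if "q \<in> ?C" for q
  proof -
    note q = column_group_permutes[OF that]
    show "permutation q" using q X unfolding permutation_permutes by blast
  qed (fact inv_in_column_group[OF that] permutes_inv_inv[OF column_group_permutes[OF that]]
      permutes_bij[OF column_group_permutes[OF that]] permutes_inv_o[OF column_group_permutes[OF that]])+
  have finG: "finite ?G" using X by (rule finite_permutations)
  have "mixed_vector X f (polytabloid lam (f \<circ> t)) (tabloid lam (f \<circ> t')) v =
      (\<Sum>p\<in>?G. \<Sum>q\<in>?C. (of_int (sign q) * (if p \<circ> q \<in> ?R then 1 else 0)) *\<^sub>C perm_act p v)"
    unfolding mixed_vector_def by (intro sum.cong refl) (simp add: coeff cfun.scale_sum_left)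
  also have "\<dots> = (\<Sum>q\<in>?C. \<Sum>p\<in>?G. (of_int (sign q) * (if p \<circ> q \<in> ?R then 1 else 0)) *\<^sub>C perm_act p v)"
    by (rule sum.swap)
  also have "\<dots> = (\<Sum>q\<in>?C. \<Sum>p\<in>?R. of_int (sign q) *\<^sub>C perm_act p (perm_act (inv q) v))"
  proof (rule sum.cong[OF refl])
    fix q assume q: "q \<in> ?C"
    have qX: "q permutes X" using q by (rule column_group_permutes)
    have "(\<Sum>p\<in>?G. (of_int (sign q) * (if p \<circ> q \<in> ?R then 1 else 0)) *\<^sub>C perm_act p v) =
        (\<Sum>p\<in>{p \<in> ?G. p \<circ> q \<in> ?R}. of_int (sign q) *\<^sub>C perm_act p v)"
      using finG by (intro sum.mono_neutral_cong_right) auto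
    also have "\<dots> = (\<Sum>p\<in>?R. of_int (sign q) *\<^sub>C perm_act (p \<circ> inv q) v)"
    proof (rule sum.reindex_bij_witness[where i = "\<lambda>p. p \<circ> inv q" and j = "\<lambda>p. p \<circ> q"])
      fix p :: "nat \<Rightarrow> nat"
      show "p \<circ> q \<circ> inv q = p" "p \<circ> inv q \<circ> q = p" using inv[OF q] by (simp_all add: comp_assoc)
      then show "of_int (sign q) *\<^sub>C perm_act (p \<circ> q \<circ> inv q) v = of_int (sign q) *\<^sub>C perm_act p v"
        and "p \<in> ?R \<Longrightarrow> p \<circ> inv q \<in> {p \<in> ?G. p \<circ> q \<in> ?R}"
        using permutes_compose[OF permutes_inv[OF qX], of p] by (auto simp: row_coset_def)
    qed auto
    also have "\<dots> = (\<Sum>p\<in>?R. of_int (sign q) *\<^sub>C perm_act p (perm_act (inv q) v))"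
      using inv(4)[OF inv(1)[OF q]]
      by (intro sum.cong refl) (auto simp: row_coset_def perm_act_compose permutes_bij)
    finally show "(\<Sum>p\<in>?G. (of_int (sign q) * (if p \<circ> q \<in> ?R then 1 else 0)) *\<^sub>C perm_act p v) =
        (\<Sum>p\<in>?R. of_int (sign q) *\<^sub>C perm_act p (perm_act (inv q) v))" .
  qed
  also have "\<dots> = (\<Sum>q\<in>?C. \<Sum>p\<in>?R. of_int (sign q) *\<^sub>C perm_act p (perm_act q v))"
    by (rule sum.reindex_bij_witness[where i = inv and j = inv]) (simp_all add: inv sign_inverse)
  also have "\<dots> = row_sum lam X t t' (column_antisym lam X t v)"
    unfolding row_sum_def column_antisym_def perm_act_sum perm_act_scale by (rule sum.swap)
  finally show ?thesis .
qed

lemma tabloid_ip_perm_act: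
  assumes q: "q permutes {1..psize lam}"
  shows "tabloid_ip lam (perm_act q u) (perm_act q v) = tabloid_ip lam u v"
proof -
  have tab: "(\<lambda>i. p ` T i) \<in> tabloids lam" if "T \<in> tabloids lam" "p permutes {1..psize lam}" for T p
    using that tableau_perm[of lam _ p] unfolding tabloids_def by (auto simp flip: tabloid_comp)
  note tab_q = tab[OF _ q] tab[OF _ permutes_inv[OF q]]
  have qi: "q ` inv q ` A = A" "inv q ` q ` A = A" for A
    using q by (simp_all add: image_f_inv_f image_inv_f_f permutes_surj permutes_inj)
  show ?thesis
    unfolding tabloid_ip_def perm_act_def
    by (rule sum.reindex_bij_witness[where i = "\<lambda>T i. q ` T i" and j = "\<lambda>T i. inv q ` T i"])
      (simp_all add: qi tab_q)
qed

subsection \<open>The Gram formula\<close>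

lemma mixed_vector_sum:
  "mixed_vector X f (\<Sum>b\<in>A. c b *\<^sub>C b) T v = (\<Sum>b\<in>A. c b *\<^sub>C mixed_vector X f b T v)"
proof (induction A rule: infinite_finite_induct)
  case (insert b A)
  then show ?case by (simp only: sum.insert mixed_vector_add mixed_vector_scale simp_thms)
qed (simp_all only: sum.infinite sum.empty mixed_vector_0 simp_thms)

lemma exists_tabloid_expansion_system:
  assumes lam: "is_partition lam"
  shows "\<exists>B. expansion_system (specht lam) (tabloid_ip lam) B"
proof -
  interpret inner_product_subspace "specht lam" "tabloid_ip lam"
    by unfold_locales (simp_all add: subspace_specht inner_product_tabloid_ip lam)
  show ?thesis
    using finite_imageI[OF finite_tabloids[OF lam]] specht_subset_span_point[OF lam]
    by (rule exists_expansion_system)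
qed

locale unitary_specht =
  fixes nu :: "nat \<Rightarrow> nat"
    and ip :: "((nat \<Rightarrow> nat set) \<Rightarrow> complex) \<Rightarrow> ((nat \<Rightarrow> nat set) \<Rightarrow> complex) \<Rightarrow> complex"
  assumes nu: "is_partition nu"
    and inner_ip: "inner_product_on (specht nu) ip"
    and unitary: "\<And>p. p permutes {1..psize nu} \<Longrightarrow> unitary_on (specht nu) ip (perm_act p)"
begin

sublocale V: inner_product_subspace "specht nu" ip
  by unfold_locales (fact subspace_specht inner_ip)+

text \<open>Up to a positive factor, this is the projection to the isotypic component of type \<open>lam\<close> under
  the permutations of \<open>X\<close>.\<close>

definition char_act :: "nat set \<Rightarrow> (nat \<Rightarrow> nat) \<Rightarrow>
    ((nat \<Rightarrow> nat set) \<Rightarrow> complex) \<Rightarrow> (nat \<Rightarrow> nat set) \<Rightarrow> complex"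
  where "char_act X lam v = (\<Sum>p | p permutes X. specht_char_on X lam p *\<^sub>C perm_act p v)"

lemma char_act_mem:
  assumes "X \<subseteq> {1..psize nu}" "v \<in> specht nu"
  shows "char_act X lam v \<in> specht nu"
  unfolding char_act_def using perm_act_specht_on[OF _ assms]
  by (intro V.sum_mem V.scale_mem) simp

text \<open>This is the Schur product theorem for positive definite functions on a group.  Write the character
  as a trace, that is, as the sum of \<open>\<langle>p b, b\<rangle>\<close> over an expansion system.  By invariance,
  \<open>\<langle>p b, b\<rangle> \<langle>p v, w\<rangle> = \<langle>q p b, q b\<rangle> \<langle>q p v, q w\<rangle>\<close> for every permutation \<open>q\<close> of \<open>X\<close>; summing over \<open>q\<close> too,
  and expanding the first factor in the basis of tabloids, splits the double sum over \<open>p\<close> and \<open>q\<close> into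
  inner products.\<close>

lemma char_act_gram:
  assumes lam: "is_partition lam" and X: "X \<subseteq> {1..psize nu}" "card X = psize lam"
    and B: "expansion_system (specht lam) (tabloid_ip lam) B"
    and f: "f = (\<lambda>x. card {y \<in> X. y \<le> x})"
    and v: "v \<in> specht nu" and w: "w \<in> specht nu"
  shows "of_nat (card {p. p permutes X}) * ip (char_act X lam v) w =
    (\<Sum>b\<in>B. \<Sum>T\<in>tabloids lam. ip (mixed_vector X f b T v) (mixed_vector X f b T w))"
proof -
  let ?G = "{p. p permutes X}" and ?m = "map_permutation X f"
  have finX: "finite X" using X(1) finite_subset by blast
  have bij_f: "bij_betw f X {1..psize lam}" using bij_betw_rank[OF finX] by (simp add: f X(2))
  have inj: "inj_on f X" using bij_f by (rule bij_betw_imp_inj_on)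
  have m_perm: "?m p permutes {1..psize lam}" if "p \<in> ?G" for p
    using map_permutation_permutes[OF bij_f] that by simp
  have mem: "perm_act p x \<in> specht nu" if "p \<in> ?G" "x \<in> specht nu" for p x
    using that by (intro perm_act_specht_on[OF _ X(1)]) simp_all
  have ip_inv: "ip (perm_act q x) (perm_act q y) = ip x y"
    if "q \<in> ?G" "x \<in> specht nu" "y \<in> specht nu" for q x y
    using unitary[OF permutes_subset[of q X]] that X(1) by (simp add: unitary_on_def)
  interpret U: inner_product_subspace "specht lam" "tabloid_ip lam"
    by unfold_locales (simp_all add: subspace_specht inner_product_tabloid_ip lam)
  have char: "specht_char_on X lam p = (\<Sum>b\<in>B. tabloid_ip lam (perm_act (?m p) b) b)" if "p \<in> ?G" for p
    unfolding specht_char_on_def specht_char_def f[symmetric]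
  proof (rule U.trace_on_eq_sum_ip)
    show "finite (point ` tabloids lam)" using finite_tabloids[OF lam] by simp
    show "perm_act (?m p) x \<in> specht lam" if "x \<in> specht lam" for x
      using m_perm[OF \<open>p \<in> ?G\<close>] that by (rule perm_act_specht)
  qed (fact specht_subset_span_point[OF lam] linear_perm_act B)+
  have shift: "(\<Sum>p\<in>?G. F p) = (\<Sum>p\<in>?G. F (q \<circ> p))" if q: "q \<in> ?G" for F :: "(nat \<Rightarrow> nat) \<Rightarrow> complex" and q
  proof (rule sum.reindex_bij_witness[where i = "\<lambda>p. q \<circ> p" and j = "\<lambda>p. inv q \<circ> p"])
    fix p assume p: "p \<in> ?G"
    show "q \<circ> (inv q \<circ> p) = p" "inv q \<circ> (q \<circ> p) = p"
      using q by (auto simp: permutes_inv_o simp flip: comp_assoc)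
    then show "F (q \<circ> (inv q \<circ> p)) = F p" by simp
    show "inv q \<circ> p \<in> ?G" "q \<circ> p \<in> ?G" using p q by (auto intro: permutes_compose permutes_inv)
  qed
  let ?h = "\<lambda>b p. tabloid_ip lam (perm_act (?m p) b) b * ip (perm_act p v) w"
  have ip_char: "ip (char_act X lam v) w = (\<Sum>b\<in>B. \<Sum>p\<in>?G. ?h b p)"
  proof -
    have "ip (char_act X lam v) w = (\<Sum>p\<in>?G. specht_char_on X lam p * ip (perm_act p v) w)"
      unfolding char_act_def using mem v w
      by (subst V.ip_sum_left) (auto simp: V.ip_scale_left V.scale_mem)
    also have "\<dots> = (\<Sum>p\<in>?G. \<Sum>b\<in>B. ?h b p)"
      by (intro sum.cong refl) (simp only: char sum_distrib_right)
    finally show ?thesis by (simp only: sum.swap[of _ B])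
  qed
  have "(\<Sum>T\<in>tabloids lam. ip (mixed_vector X f b T v) (mixed_vector X f b T w)) =
      of_nat (card ?G) * (\<Sum>p\<in>?G. ?h b p)" for b
  proof -
    have "(\<Sum>T\<in>tabloids lam. ip (mixed_vector X f b T v) (mixed_vector X f b T w)) =
        (\<Sum>T\<in>tabloids lam. \<Sum>q\<in>?G. \<Sum>p\<in>?G. perm_act (?m p) b T * cnj (perm_act (?m q) b T) *
          ip (perm_act p v) (perm_act q w))"
      unfolding mixed_vector_def using mem v w
      by (intro sum.cong refl, subst V.ip_sum_sum, simp_all only: mem_Collect_eq) (rule sum.swap)
    also have "\<dots> = (\<Sum>q\<in>?G. \<Sum>T\<in>tabloids lam. \<Sum>p\<in>?G. perm_act (?m p) b T * cnj (perm_act (?m q) b T) *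
          ip (perm_act p v) (perm_act q w))"
      by (rule sum.swap)
    also have "\<dots> = (\<Sum>q\<in>?G. \<Sum>p\<in>?G. \<Sum>T\<in>tabloids lam. perm_act (?m p) b T * cnj (perm_act (?m q) b T) *
          ip (perm_act p v) (perm_act q w))"
      by (rule sum.cong[OF refl], rule sum.swap)
    also have "\<dots> = (\<Sum>q\<in>?G. \<Sum>p\<in>?G.
        tabloid_ip lam (perm_act (?m p) b) (perm_act (?m q) b) * ip (perm_act p v) (perm_act q w))"
      by (simp only: tabloid_ip_def sum_distrib_right)
    also have "\<dots> = (\<Sum>q\<in>?G. \<Sum>p\<in>?G. ?h b p)"
    proof (rule sum.cong[OF refl])
      fix q assume q: "q \<in> ?G"
      have "(\<Sum>p\<in>?G. tabloid_ip lam (perm_act (?m p) b) (perm_act (?m q) b) *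
            ip (perm_act p v) (perm_act q w)) =
          (\<Sum>p\<in>?G. tabloid_ip lam (perm_act (?m (q \<circ> p)) b) (perm_act (?m q) b) *
            ip (perm_act (q \<circ> p) v) (perm_act q w))"
        using q by (rule shift)
      also have "\<dots> = (\<Sum>p\<in>?G. ?h b p)"
      proof (rule sum.cong[OF refl])
        fix p assume p: "p \<in> ?G"
        have "perm_act (?m (q \<circ> p)) b = perm_act (?m q) (perm_act (?m p) b)"
          using map_permutation_compose'[OF inj, of p q] p m_perm[OF p] m_perm[OF q]
          by (simp add: perm_act_compose permutes_bij)
        moreover have "perm_act (q \<circ> p) v = perm_act q (perm_act p v)"
          using p q by (simp add: perm_act_compose permutes_bij)
        ultimately show "tabloid_ip lam (perm_act (?m (q \<circ> p)) b) (perm_act (?m q) b) *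
            ip (perm_act (q \<circ> p) v) (perm_act q w) = ?h b p"
          using tabloid_ip_perm_act[OF m_perm[OF q]] ip_inv[OF q mem[OF p v] w] by simp
      qed
      finally show "(\<Sum>p\<in>?G. tabloid_ip lam (perm_act (?m p) b) (perm_act (?m q) b) *
            ip (perm_act p v) (perm_act q w)) = (\<Sum>p\<in>?G. ?h b p)" .
    qed
    finally show ?thesis by simp
  qed
  then show ?thesis by (simp add: ip_char sum_distrib_left)
qed

lemma mixed_vector_mem:
  assumes "X \<subseteq> {1..psize nu}" "v \<in> specht nu"
  shows "mixed_vector X f u T v \<in> specht nu"
  unfolding mixed_vector_def using perm_act_specht_on[OF _ assms]
  by (intro V.sum_mem V.scale_mem) simp

lemma card_permutes_pos: "finite X \<Longrightarrow> 0 < card {p. p permutes X}"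
  by (simp add: card_permutations[OF refl])

lemma char_act_hermitian:
  assumes lam: "is_partition lam" and X: "X \<subseteq> {1..psize nu}" "card X = psize lam"
    and v: "v \<in> specht nu" and w: "w \<in> specht nu"
  shows "ip (char_act X lam v) w = cnj (ip (char_act X lam w) v)"
proof -
  obtain B where B: "expansion_system (specht lam) (tabloid_ip lam) B"
    using exists_tabloid_expansion_system[OF lam] by blast
  note gram = char_act_gram[OF lam X B refl]
  have finX: "finite X" using X(1) finite_subset by blast
  have "of_nat (card {p. p permutes X}) * ip (char_act X lam v) w =
      cnj (of_nat (card {p. p permutes X}) * ip (char_act X lam w) v)"
    unfolding gram[OF v w] gram[OF w v] cnj_sum
    using mixed_vector_mem[OF X(1) v] mixed_vector_mem[OF X(1) w]
    by (intro sum.cong refl V.ip_commute)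
  then show ?thesis using card_permutes_pos[OF finX] by simp
qed

text \<open>A diagonal entry of the Gram matrix is a sum of squares.  If it vanishes, so do the mixed
  vectors of the members of an expansion system, and by linearity those of all \<open>u\<close>.\<close>

lemma char_act_nonneg:
  assumes lam: "is_partition lam" and X: "X \<subseteq> {1..psize nu}" "card X = psize lam"
    and v: "v \<in> specht nu"
  shows "0 \<le> Re (ip (char_act X lam v) v)"
    and "Re (ip (char_act X lam v) v) = 0 \<Longrightarrow> u \<in> specht lam \<Longrightarrow> T \<in> tabloids lam \<Longrightarrow>
      mixed_vector X (\<lambda>x. card {y \<in> X. y \<le> x}) u T v = 0"
proof -
  obtain B where B: "expansion_system (specht lam) (tabloid_ip lam) B"
    using exists_tabloid_expansion_system[OF lam] by blast
  then have finB: "finite B" and B_sub: "B \<subseteq> specht lam" unfolding expansion_system_def by blast+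
  define f where "f = (\<lambda>x. card {y \<in> X. y \<le> x})"
  define M where "M b T = mixed_vector X f b T v" for b T
  have M: "M b T \<in> specht nu" for b T unfolding M_def using X(1) v by (rule mixed_vector_mem)
  let ?N = "card {p. p permutes X}"
  have "Re (of_nat ?N * ip (char_act X lam v) v) = (\<Sum>b\<in>B. \<Sum>T\<in>tabloids lam. Re (ip (M b T) (M b T)))"
    unfolding char_act_gram[OF lam X B f_def v v] M_def by simp
  then have gram: "of_nat ?N * Re (ip (char_act X lam v) v) =
      (\<Sum>b\<in>B. \<Sum>T\<in>tabloids lam. Re (ip (M b T) (M b T)))" by simp
  have N: "0 < ?N" using X(1) finite_subset by (intro card_permutes_pos) blast
  have "0 \<le> of_nat ?N * Re (ip (char_act X lam v) v)"
    unfolding gram using M by (intro sum_nonneg V.ip_self_nonneg)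
  then show "0 \<le> Re (ip (char_act X lam v) v)" using N by (simp add: zero_le_mult_iff)
  assume zero: "Re (ip (char_act X lam v) v) = 0" and u: "u \<in> specht lam" and T: "T \<in> tabloids lam"
  have "(\<Sum>b\<in>B. \<Sum>T\<in>tabloids lam. Re (ip (M b T) (M b T))) = 0" using zero gram by simp
  then have "Re (ip (M b T) (M b T)) = 0" if "b \<in> B" for b
    using that T finB finite_tabloids[OF lam] M V.ip_self_nonneg
    by (simp add: sum_nonneg_eq_0_iff sum_nonneg)
  then have MB: "M b T = 0" if "b \<in> B" for b using that V.ip_self_eq_0_iff[OF M] by blast
  have "u = (\<Sum>b\<in>B. tabloid_ip lam u b *\<^sub>C b)"
    using B u unfolding expansion_system_def by blast
  then have "M u T = M (\<Sum>b\<in>B. tabloid_ip lam u b *\<^sub>C b) T" by (rule arg_cong)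
  also have "\<dots> = (\<Sum>b\<in>B. tabloid_ip lam u b *\<^sub>C M b T)"
    unfolding M_def by (rule mixed_vector_sum)
  also have "\<dots> = 0" using MB by (intro sum.neutral ballI) simp
  finally have "M u T = 0" .
  then show "mixed_vector X (\<lambda>x. card {y \<in> X. y \<le> x}) u T v = 0" by (simp only: M_def f_def)
qed

lemma char_act_pos:
  assumes lam: "is_partition lam" and X: "X \<subseteq> {1..psize nu}" "card X = psize lam"
    and v: "v \<in> specht nu" and t: "bij_betw t (diagram lam) X"
    and nz: "row_sum lam X t t (column_antisym lam X t v) \<noteq> 0"
  shows "0 < Re (ip (char_act X lam v) v)"
proof (rule ccontr)
  let ?f = "\<lambda>x. card {y \<in> X. y \<le> x}"
  assume "\<not> ?thesis"
  then have zero: "Re (ip (char_act X lam v) v) = 0" using char_act_nonneg(1)[OF lam X v] by simp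
  have finX: "finite X" using X(1) finite_subset by blast
  have f: "bij_betw ?f X {1..psize lam}" using bij_betw_rank[OF finX] by (simp only: X(2))
  have tab: "tableau lam (?f \<circ> t)" unfolding tableau_def using t f by (rule bij_betw_trans)
  have im: "t ` diagram lam \<subseteq> X" using bij_betw_imp_surj_on[OF t] by simp
  have "tabloid lam (?f \<circ> t) \<in> tabloids lam" using tab unfolding tabloids_def by blast
  with char_act_nonneg(2)[OF lam X v zero polytabloid_in_specht[OF tab]]
  have "mixed_vector X ?f (polytabloid lam (?f \<circ> t)) (tabloid lam (?f \<circ> t)) v = 0" by blast
  then show False using nz by (simp only: mixed_vector_polytabloid[OF finX f im im])
qed

text \<open>All mixed vectors of polytabloids vanish, so the Gram formula with \<open>w = char_act X lam v\<close> leaves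
  no room for a nonzero \<open>w\<close>.\<close>

lemma char_act_eq_0:
  assumes lam: "is_partition lam" and X: "X \<subseteq> {1..psize nu}" "card X = psize lam"
    and v: "v \<in> specht nu" and nle: "\<not> (\<forall>i. lam i \<le> nu i)"
  shows "char_act X lam v = 0"
proof -
  define f where "f = (\<lambda>x. card {y \<in> X. y \<le> x})"
  obtain B where B: "expansion_system (specht lam) (tabloid_ip lam) B"
    using exists_tabloid_expansion_system[OF lam] by blast
  then have B_sub: "B \<subseteq> specht lam" unfolding expansion_system_def by blast
  have finX: "finite X" using X(1) finite_subset by blast
  have f: "bij_betw f X {1..psize lam}" using bij_betw_rank[OF finX] by (simp only: X(2) f_def)
  let ?g = "inv_into X f"
  have pull: "bij_betw (?g \<circ> s) (diagram lam) X" "(?g \<circ> s) ` diagram lam \<subseteq> X"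
    "\<And>d. d \<in> diagram lam \<Longrightarrow> (f \<circ> (?g \<circ> s)) d = s d" if s: "tableau lam s" for s
  proof -
    have s': "bij_betw s (diagram lam) {1..psize lam}" using s by (simp add: tableau_def)
    show bij: "bij_betw (?g \<circ> s) (diagram lam) X" using s' bij_betw_inv_into[OF f] by (rule bij_betw_trans)
    then show "(?g \<circ> s) ` diagram lam \<subseteq> X" by (simp add: bij_betw_def)
    show "(f \<circ> (?g \<circ> s)) d = s d" if "d \<in> diagram lam" for d
      using bij_betw_inv_into_right[OF f, of "s d"] bij_betwE[OF s'] that by (simp add: comp_def)
  qed
  have poly_cong: "polytabloid lam s = polytabloid lam s'" if "\<And>d. d \<in> diagram lam \<Longrightarrow> s d = s' d" for s s'
  proof -
    have "column_stabilizer lam s = column_stabilizer lam s'"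
      using tableau_column_cong[OF that] by (simp only: column_stabilizer_def)
    moreover have "tabloid lam (p \<circ> s) = tabloid lam (p \<circ> s')" for p
      by (simp only: tabloid_comp tabloid_cong[OF that])
    ultimately show ?thesis by (simp only: polytabloid_def)
  qed
  have zero: "mixed_vector X f u T v = 0" if u: "u \<in> specht lam" and T: "T \<in> tabloids lam" for u T
    using u
  proof (induction rule: specht_induct)
    case (polytabloid s)
    obtain s' where s': "tableau lam s'" "T = tabloid lam s'" using T by (auto simp: tabloids_def)
    have "row_sum lam X (?g \<circ> s) (?g \<circ> s') (column_antisym lam X (?g \<circ> s) v) = 0"
      using nu lam nle X(1) pull(1)[OF polytabloid] pull(1)[OF s'(1)] v
      by (rule row_sum_column_antisym_eq_0)
    then have "mixed_vector X f (polytabloid lam (f \<circ> (?g \<circ> s))) (tabloid lam (f \<circ> (?g \<circ> s'))) v = 0"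
      by (simp only: mixed_vector_polytabloid[OF finX f pull(2)[OF polytabloid] pull(2)[OF s'(1)]])
    then show ?case
      by (simp only: poly_cong[OF pull(3)[OF polytabloid]] tabloid_cong[OF pull(3)[OF s'(1)]] s'(2))
  qed (simp_all only: mixed_vector_0 mixed_vector_add mixed_vector_scale cfun.scale_zero_right add_0_left)
  let ?x = "char_act X lam v"
  have x: "?x \<in> specht nu" using X(1) v by (rule char_act_mem)
  have "mixed_vector X f b T v = 0" if "b \<in> B" "T \<in> tabloids lam" for b T
    using that B_sub by (intro zero) auto
  then have "of_nat (card {p. p permutes X}) * ip ?x ?x = 0"
    unfolding char_act_gram[OF lam X B f_def v x]
    using V.ip_zero_left[OF mixed_vector_mem[OF X(1) x]] by (intro sum.neutral ballI) simp
  then have "ip ?x ?x = 0" using card_permutes_pos[OF finX] by simp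
  then show ?thesis using V.ip_self_eq_0_iff[OF x] by simp
qed

end

section \<open>The operator of the group algebra element\<close>

lemma card_diagram:
  assumes "is_partition lam"
  shows "card (diagram lam) = psize lam"
proof -
  have "diagram lam = Sigma {i. lam i \<noteq> 0} (\<lambda>i. {..<lam i})" by (auto simp: diagram_def)
  then show ?thesis using assms by (simp add: psize_def is_partition_def)
qed

lemma group_algebra_act_beta:
  "group_algebra_act n (beta n z lam) v =
    (\<Sum>X | X \<subseteq> {1..n} \<and> card X = psize lam. (\<Prod>i\<in>{1..n} - X. z i) *\<^sub>C
      (\<Sum>p | p permutes X. specht_char_on X lam p *\<^sub>C perm_act p v))"
proof -
  let ?S = "{X. X \<subseteq> {1..n} \<and> card X = psize lam}" and ?G = "{p. p permutes {1..n}}"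
  let ?c = "\<lambda>X p. specht_char_on X lam p * (\<Prod>i\<in>{1..n} - X. z i)"
  have "beta n z lam q = (\<Sum>X\<in>?S. \<Sum>p | p permutes X. if q = p then ?c X p else 0)" for q
    unfolding beta_def sum_fun_apply cscale_def point_def by (intro sum.cong refl) simp
  also have "\<dots> q = (\<Sum>X\<in>?S. if q permutes X then ?c X q else 0)" for q
    by (intro sum.cong refl) (auto simp: finite_permutations finite_subset)
  finally have beta: "beta n z lam q = (\<Sum>X\<in>?S. if q permutes X then ?c X q else 0)" for q .
  have "group_algebra_act n (beta n z lam) v =
      (\<Sum>q\<in>?G. \<Sum>X\<in>?S. (if q permutes X then ?c X q else 0) *\<^sub>C perm_act q v)"
    unfolding group_algebra_act_def beta by (simp only: cfun.scale_sum_left)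
  also have "\<dots> = (\<Sum>X\<in>?S. \<Sum>q\<in>?G. (if q permutes X then ?c X q else 0) *\<^sub>C perm_act q v)"
    by (rule sum.swap)
  also have "\<dots> = (\<Sum>X\<in>?S. (\<Prod>i\<in>{1..n} - X. z i) *\<^sub>C
      (\<Sum>p | p permutes X. specht_char_on X lam p *\<^sub>C perm_act p v))"
  proof (intro sum.cong refl)
    fix X assume "X \<in> ?S"
    then have "{p. p permutes X} \<subseteq> ?G" by (auto intro: permutes_subset)
    then have "(\<Sum>q\<in>?G. (if q permutes X then ?c X q else 0) *\<^sub>C perm_act q v) =
        (\<Sum>q | q permutes X. ?c X q *\<^sub>C perm_act q v)"
      by (intro sum.mono_neutral_cong_right) (auto simp: finite_permutations)
    then show "(\<Sum>q\<in>?G. (if q permutes X then ?c X q else 0) *\<^sub>C perm_act q v) =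
        (\<Prod>i\<in>{1..n} - X. z i) *\<^sub>C (\<Sum>p | p permutes X. specht_char_on X lam p *\<^sub>C perm_act p v)"
      by (simp add: cfun.scale_sum_right mult.commute)
  qed
  finally show ?thesis .
qed

theorem proposition1p12:
  fixes n :: nat
    and z :: "nat \<Rightarrow> complex"
    and nu lam :: "nat \<Rightarrow> nat"
    and ip :: "((nat \<Rightarrow> nat set) \<Rightarrow> complex) \<Rightarrow> ((nat \<Rightarrow> nat set) \<Rightarrow> complex) \<Rightarrow> complex"
  assumes "is_partition nu" and "psize nu = n"
    and "is_partition lam"
    and "inner_product_on (specht nu) ip"
    and "\<And>p. p permutes {1..n} \<Longrightarrow> unitary_on (specht nu) ip (perm_act p)"
  shows "((\<forall>i\<in>{1..n}. z i \<in> \<real>) \<longrightarrow>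
           self_adjoint_on (specht nu) ip (group_algebra_act n (beta n z lam))) \<and>
         ((\<forall>i\<in>{1..n}. z i \<in> complex_of_real ` {0..}) \<longrightarrow>
           positive_semidefinite_on (specht nu) ip (group_algebra_act n (beta n z lam))) \<and>
         ((\<forall>i\<in>{1..n}. z i \<in> complex_of_real ` {0<..}) \<and> (\<forall>i. lam i \<le> nu i) \<longrightarrow>
           positive_definite_on (specht nu) ip (group_algebra_act n (beta n z lam))) \<and>
         (\<not> (\<forall>i. lam i \<le> nu i) \<longrightarrow>
           (\<forall>v\<in>specht nu. group_algebra_act n (beta n z lam) v = 0))"
proof -
  interpret unitary_specht nu ip
    using assms by unfold_locales auto
  let ?\<beta> = "group_algebra_act n (beta n z lam)"
  define S where "S = {X. X \<subseteq> {1..n} \<and> card X = psize lam}"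
  have finS: "finite S" unfolding S_def by (rule finite_subset[of _ "Pow {1..n}"]) auto
  have S: "X \<subseteq> {1..psize nu}" "card X = psize lam" if "X \<in> S" for X
    using that assms(2) by (auto simp: S_def)
  note char_S = char_act_hermitian[OF assms(3) S] char_act_nonneg(1)[OF assms(3) S]
  have beta: "?\<beta> v = (\<Sum>X\<in>S. (\<Prod>i\<in>{1..n} - X. z i) *\<^sub>C char_act X lam v)" for v
    unfolding S_def char_act_def by (rule group_algebra_act_beta)
  have mem: "?\<beta> v \<in> specht nu" if "v \<in> specht nu" for v
    using group_algebra_act_specht[OF that] assms(2) by simp
  define r where "r X = (\<Prod>i\<in>{1..n} - X. Re (z i))" for X
  have ip_beta: "ip (?\<beta> v) w = (\<Sum>X\<in>S. of_real (r X) * ip (char_act X lam v) w)"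
    if z: "\<forall>i\<in>{1..n}. z i \<in> \<real>" and v: "v \<in> specht nu" and w: "w \<in> specht nu" for v w
  proof -
    have "(\<Prod>i\<in>{1..n} - X. z i) = of_real (r X)" for X
      unfolding r_def of_real_prod using z by (intro prod.cong refl) auto
    then show ?thesis
      unfolding beta using S v w
      by (subst V.ip_sum_left) (auto simp: V.ip_scale_left V.scale_mem char_act_mem)
  qed
  have self_adjoint: "self_adjoint_on (specht nu) ip ?\<beta>" if z: "\<forall>i\<in>{1..n}. z i \<in> \<real>"
    unfolding self_adjoint_on_def
  proof (intro conjI ballI)
    show "?\<beta> ` specht nu \<subseteq> specht nu" using mem by blast
    fix v w assume v: "v \<in> specht nu" and w: "w \<in> specht nu"
    have "ip (?\<beta> v) w = (\<Sum>X\<in>S. of_real (r X) * cnj (ip (char_act X lam w) v))"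
      unfolding ip_beta[OF z v w] by (intro sum.cong refl arg_cong2[where f = times] char_S(1) v w)
    also have "\<dots> = cnj (ip (?\<beta> w) v)" unfolding ip_beta[OF z w v] by simp
    also have "\<dots> = ip v (?\<beta> w)" by (rule V.ip_commute[OF v mem[OF w], symmetric])
    finally show "ip (?\<beta> v) w = ip v (?\<beta> w)" .
  qed
  have Re_beta: "Re (ip (?\<beta> v) v) = (\<Sum>X\<in>S. r X * Re (ip (char_act X lam v) v))"
    if "\<forall>i\<in>{1..n}. z i \<in> \<real>" "v \<in> specht nu" for v
    unfolding ip_beta[OF that(1,2,2)] by simp

  have "positive_semidefinite_on (specht nu) ip ?\<beta>"
    if z: "\<forall>i\<in>{1..n}. z i \<in> complex_of_real ` {0..}"
    unfolding positive_semidefinite_on_def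
  proof (intro conjI ballI)
    have zr: "\<forall>i\<in>{1..n}. z i \<in> \<real>" using z by auto
    then show "self_adjoint_on (specht nu) ip ?\<beta>" by (rule self_adjoint)
    have "0 \<le> Re (z i)" if "i \<in> {1..n}" for i using bspec[OF z that] by auto
    then have "0 \<le> r X" for X unfolding r_def by (intro prod_nonneg) simp
    then show "0 \<le> Re (ip (?\<beta> v) v)" if "v \<in> specht nu" for v
      unfolding Re_beta[OF zr that] using that by (intro sum_nonneg mult_nonneg_nonneg char_S(2))
  qed
  moreover have "positive_definite_on (specht nu) ip ?\<beta>"
    if z: "\<forall>i\<in>{1..n}. z i \<in> complex_of_real ` {0<..}" and le: "\<forall>i. lam i \<le> nu i"
    unfolding positive_definite_on_def
  proof (intro conjI ballI impI)
    have zr: "\<forall>i\<in>{1..n}. z i \<in> \<real>" using z by auto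
    then show "self_adjoint_on (specht nu) ip ?\<beta>" by (rule self_adjoint)
    have "0 < Re (z i)" if "i \<in> {1..n}" for i using bspec[OF z that] by auto
    then have r: "0 < r X" for X unfolding r_def by (intro prod_pos) simp
    fix v assume v: "v \<in> specht nu" "v \<noteq> 0"
    obtain X t where X: "X \<subseteq> {1..psize nu}" and t: "bij_betw t (diagram lam) X"
      and nz: "row_sum lam X t t (column_antisym lam X t v) \<noteq> 0"
      using exists_row_sum_column_antisym_nonzero[OF assms(1) v le] by blast
    have card: "card X = psize lam" using bij_betw_same_card[OF t] card_diagram[OF assms(3)] by simp
    show "0 < Re (ip (?\<beta> v) v)"
      unfolding Re_beta[OF zr v(1)]
    proof (rule sum_pos2[OF finS])
      show "X \<in> S" using X card assms(2) by (simp add: S_def)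
      show "0 < r X * Re (ip (char_act X lam v) v)"
        using r char_act_pos[OF assms(3) X card v(1) t nz] by (intro mult_pos_pos)
      show "0 \<le> r Y * Re (ip (char_act Y lam v) v)" if "Y \<in> S" for Y
        using char_S(2)[OF that that v(1)] r[of Y] by (intro mult_nonneg_nonneg) auto
    qed
  qed
  moreover have "?\<beta> v = 0" if "\<not> (\<forall>i. lam i \<le> nu i)" "v \<in> specht nu" for v
    unfolding beta using S char_act_eq_0[OF assms(3) _ _ that(2,1)] by (intro sum.neutral ballI) simp
  ultimately show ?thesis using self_adjoint by blast
qed

end
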